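(* Let $\kappa>1$ be a real number. Then \[ \limsup_{n\to\infty}\frac{\zeta(\kappa)\,\sigma^{[\kappa]}(n)}{(e^{\gamma}n\log\log n)^{\kappa}}=1. \]
   Context: For real $\kappa>0$ and a positive integer $n$, $\sigma^{[\kappa]}(n):=\sum_{d\mid n}\mu(n/d)\sigma(d)^{\kappa}$, where $\sigma$ is the sum-of-divisors function and $\mu$ the Möbius function (for integer $\kappa=k$ this equals $\sum_{\operatorname{lcm}(d_1,\dots,d_k)=n}d_1\cdots d_k$). $\gamma$ is the Euler–Mascheroni constant and $\zeta$ the Riemann zeta function. *)

theory Defs
  imports "HOL-Analysis.Analysis" "HOL-Computational_Algebra.Squarefree"
begin

definition divisor_sum :: "nat \<Rightarrow> nat" where
  "divisor_sum n = (\<Sum>d | d dvd n. d)"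

definition moebius :: "nat \<Rightarrow> int" where
  "moebius n = (if squarefree n then (-1) ^ card (prime_factors n) else 0)"

text \<open>The arithmetic functions here are meant for positive arguments. At \<open>0\<close> the set of
  divisors is infinite, so the divisor sums take the junk value \<open>0\<close>.
  The name of the next function refers to the case of a positive integer exponent \<open>k\<close>, in which it is the sum of
  \<open>d\<^sub>1 \<cdots> d\<^sub>k\<close> over all tuples with least common multiple \<open>n\<close>.\<close>

definition divisor_sum_lcm :: "real \<Rightarrow> nat \<Rightarrow> real" where
  "divisor_sum_lcm \<kappa> n = (\<Sum>d | d dvd n. of_int (moebius (n div d)) * real (divisor_sum d) powr \<kappa>)"

text \<open>The Riemann zeta function on the real half-line \<open>s > 1\<close>, where it is given by its
  Dirichlet series. It is not meaningful for \<open>s \<le> 1\<close>.\<close>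

definition real_zeta :: "real \<Rightarrow> real" where
  "real_zeta s = (\<Sum>n. 1 / real (Suc n) powr s)"

end

theory Submission
  imports Defs "HOL-Real_Asymp.Real_Asymp"
begin

text \<open>
  The function \<open>f = divisor_sum_lcm \<kappa>\<close> is multiplicative, and its value at \<open>p\<^sup>a\<close>, divided by \<open>p\<^sup>a\<^sup>\<kappa>\<close>, is at most
  its limit \<open>(1 - p powr -\<kappa>) / (1 - 1/p) powr \<kappa>\<close> for \<open>a \<rightarrow> \<infinity>\<close>. As these limits are at least 1 and the primes above
  \<open>ln n\<close> that divide \<open>n\<close> contribute a factor \<open>1 + o(1)\<close>, the quotient \<open>f n / n powr \<kappa>\<close> is at most \<open>1 + o(1)\<close> times
  the product of the limits over \<open>p \<le> ln n\<close>, and \<open>n = \<Prod>\<^sub>p\<^sub>\<le>\<^sub>x p\<^sup>2\<^sup>M\<close> with \<open>x = exp M\<close> shows that this is sharp.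
  By the Euler product and Mertens' third theorem that product is asymptotic to
  \<open>(exp \<gamma> * ln (ln n)) powr \<kappa> / \<zeta>(\<kappa>)\<close>.

  For Mertens' theorem put \<open>u p = - ln (1 - 1/p)\<close>. The first theorem of Mertens makes the series of
  \<open>(\<Sum>e\<^sup>m < p \<le> e\<^sup>m\<^sup>+\<^sup>1. u p) - 1 / (m + 1)\<close> converge, and by Abel's theorem its sum is the limit of the
  corresponding power series at \<open>z = exp (-\<epsilon>)\<close>, which is \<open>0\<close> because both \<open>\<Sum>p. u p * p powr -\<epsilon>\<close> and
  \<open>- ln (1 - z)\<close> are \<open>ln (1 / \<epsilon>) + o(1)\<close>. Comparing with the harmonic numbers produces \<open>\<gamma>\<close>.
\<close>

section \<open>A Tauberian theorem with Euler's constant\<close>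

text \<open>Summation by parts turns the distance to the limit into
  \<open>(1 - z) * (\<Sum>m. r m * z ^ m)\<close> with remainders \<open>r m\<close> tending to 0.
  The factor \<open>1 - z\<close> kills any fixed head of that series and is cancelled by the
  geometric series that bounds the rest.\<close>

lemma Abel_limit:
  fixes c :: "nat \<Rightarrow> real"
  assumes "summable c"
  shows "((\<lambda>z. \<Sum>m. c m * z ^ m) \<longlongrightarrow> suminf c) (at_left 1)"
proof -
  define L where "L = suminf c"
  define r where "r m = (\<Sum>k<Suc m. c k) - L" for m
  have r0: "r \<longlonglongrightarrow> 0"
    unfolding r_def L_def using LIMSEQ_Suc[OF summable_LIMSEQ[OF assms]]
    by (subst LIM_zero_iff)
  then have "Bseq r" by (rule convergent_imp_Bseq[OF convergentI])
  then obtain K where K: "K > 0" "\<And>m. \<bar>r m\<bar> \<le> K"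
    by (auto simp: Bseq_def)
  have rsum: "summable (\<lambda>m. \<bar>r m\<bar> * z ^ m)" if "0 < z" "z < 1" for z :: real
    by (rule summable_comparison_test'[of "\<lambda>m. K * z ^ m" 0])
       (use that K in \<open>auto intro!: mult_right_mono\<close>)
  have eq: "(\<lambda>m. c m * z ^ m) sums (L + (1 - z) * (\<Sum>m. r m * z ^ m))" if "0 < z" "z < 1" for z :: real
  proof -
    have s: "summable (\<lambda>m. r m * z ^ m)"
      by (rule summable_rabs_cancel) (use rsum[OF that] that in \<open>simp add: abs_mult\<close>)
    \<comment> \<open>Finite summation by parts, with \<open>L\<close> subtracted from the partial
      sums; the last two terms tend to 0 and to \<open>L\<close>.\<close>
    have part: "(\<Sum>m<n. c m * z ^ m) = (1 - z) * (\<Sum>m<n. r m * z ^ m) + z ^ n * (\<Sum>k<n. c k) + L * (1 - z ^ n)" for n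
      by (induction n) (auto simp: r_def algebra_simps)
    have "(\<lambda>n. (1 - z) * (\<Sum>m<n. r m * z ^ m) + z ^ n * (\<Sum>k<n. c k) + L * (1 - z ^ n))
            \<longlonglongrightarrow> (1 - z) * (\<Sum>m. r m * z ^ m) + 0 * suminf c + L * (1 - 0)"
      using that by (intro tendsto_intros summable_LIMSEQ s assms LIMSEQ_power_zero) auto
    then show ?thesis unfolding sums_def part by (simp add: add.commute)
  qed
  have main: "\<forall>\<^sub>F z in at_left 1. \<bar>(\<Sum>m. c m * z ^ m) - L\<bar> < e" if e: "e > 0" for e
  proof -
    obtain N where N: "\<And>m. m \<ge> N \<Longrightarrow> \<bar>r m\<bar> < e / 2"
      using r0 e unfolding LIMSEQ_def by (metis diff_zero half_gt_zero dist_real_def)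
    define A where "A = (\<Sum>m<N. \<bar>r m\<bar>)"
    have A0: "A \<ge> 0" by (simp add: A_def sum_nonneg)
    have lim: "((\<lambda>z. (1 - z) * A) \<longlongrightarrow> (1 - 1) * A) (at_left (1::real))"
      by (intro tendsto_intros)
    have ev: "\<forall>\<^sub>F z in at_left (1::real). (1 - z) * A < e / 2"
      using order_tendstoD(2)[OF lim, of "e/2"] e by simp
    have ev2: "\<forall>\<^sub>F z in at_left (1::real). z \<in> {0<..<1}"
      by (rule eventually_at_left_real) simp
    show ?thesis
      using ev ev2
    proof eventually_elim
      case (elim z)
      then have z: "0 < z" "z < 1" by auto
      have "(\<Sum>m. c m * z ^ m) - L = (1 - z) * (\<Sum>m. r m * z ^ m)"
        using eq[OF z] by (simp add: sums_iff)
      moreover have "\<bar>\<Sum>m. r m * z ^ m\<bar> \<le> (\<Sum>m. \<bar>r m\<bar> * z ^ m)"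
        using summable_rabs[of "\<lambda>m. r m * z ^ m"] rsum[OF z] z by (simp add: abs_mult)
      ultimately have 1: "\<bar>(\<Sum>m. c m * z ^ m) - L\<bar> \<le> (1 - z) * (\<Sum>m. \<bar>r m\<bar> * z ^ m)"
        using z by (simp add: abs_mult)
      \<comment> \<open>Below \<open>N\<close> the power is dropped; the bound
        \<open>e / 2 * z ^ m\<close> is kept at every index, which gives a full geometric
        series.\<close>
      have "(\<Sum>m. \<bar>r m\<bar> * z ^ m) \<le> (\<Sum>m. (if m < N then \<bar>r m\<bar> else 0) + e / 2 * z ^ m)"
      proof (intro suminf_le rsum z)
        show "\<bar>r n\<bar> * z ^ n \<le> (if n < N then \<bar>r n\<bar> else 0) + e / 2 * z ^ n" for n
        proof (cases "n < N")
          case True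
          have "\<bar>r n\<bar> * z ^ n \<le> \<bar>r n\<bar>" using z by (intro mult_left_le power_le_one) auto
          moreover have "e / 2 * z ^ n \<ge> 0" using z e by auto
          ultimately show ?thesis unfolding if_P[OF True] by linarith
        next
          case False
          then show ?thesis using N[of n] z by (auto intro!: mult_right_mono)
        qed
        show "summable (\<lambda>m. (if m < N then \<bar>r m\<bar> else 0) + e / 2 * z ^ m)"
          using z by (intro summable_add summable_mult summable_geometric summable_finite[of "{..<N}"]) auto
      qed
      also have "\<dots> = A + e / 2 * (1 / (1 - z))"
      proof (subst suminf_add[symmetric])
        show "summable (\<lambda>m. if m < N then \<bar>r m\<bar> else 0)" by (rule summable_finite[of "{..<N}"]) auto
        have "(\<Sum>m. if m < N then \<bar>r m\<bar> else 0) = (\<Sum>m<N. if m < N then \<bar>r m\<bar> else 0)"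
          by (rule suminf_finite) auto
        then have "(\<Sum>m. if m < N then \<bar>r m\<bar> else 0) = A" by (simp add: A_def)
        moreover have "(\<lambda>n. e / 2 * z ^ n) sums (e / 2 * (1 / (1 - z)))"
          using z by (intro sums_mult geometric_sums) auto
        ultimately show "(\<Sum>m. if m < N then \<bar>r m\<bar> else 0) + (\<Sum>n. e / 2 * z ^ n) = A + e / 2 * (1 / (1 - z))"
          by (simp only: sums_iff)
      qed (use z in auto)
      finally have "(1 - z) * (\<Sum>m. \<bar>r m\<bar> * z ^ m) \<le> (1 - z) * (A + e / 2 * (1 / (1 - z)))"
        using z by (intro mult_left_mono) auto
      also have "\<dots> = (1 - z) * A + e / 2" using z by (simp add: field_simps)
      finally show ?case using 1 elim by linarith
    qed
  qed
  show ?thesis unfolding L_def[symmetric] tendsto_iff dist_real_def using main by blast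
qed

text \<open>Meant for \<open>u p = - ln (1 - 1 / p)\<close> on the primes. The logarithmically
  weighted bound yields convergence to some constant; the behaviour of the Dirichlet series for
  \<epsilon> tending to 0 identifies it. Euler's constant enters because the comparison terms
  \<open>1 / (m + 1)\<close> add up to harmonic numbers.\<close>

lemma mertens_tauberian:
  fixes u :: "nat \<Rightarrow> real"
  assumes nonneg: "\<And>n. u n \<ge> 0" and u01: "u 0 = 0" "u 1 = 0"
  assumes log_bound: "\<And>N. N \<ge> 1 \<Longrightarrow> \<bar>(\<Sum>n\<le>N. u n * ln n) - ln N\<bar> \<le> C"
  assumes summ: "\<And>\<epsilon>. \<epsilon> > 0 \<Longrightarrow> summable (\<lambda>n. u n * real n powr -\<epsilon>)"
  assumes lim: "((\<lambda>\<epsilon>. (\<Sum>n. u n * real n powr -\<epsilon>) + ln \<epsilon>) \<longlongrightarrow> 0) (at_right 0)"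
  shows "((\<lambda>x. (\<Sum>n\<le>nat \<lfloor>x\<rfloor>. u n) - ln (ln x)) \<longlongrightarrow> euler_mascheroni) at_top"
proof -
  define E where "E m = nat \<lfloor>exp (real m)\<rfloor>" for m
  define b where "b m = sum u {E m<..E (Suc m)}" for m
  define c where "c m = b m - 1 / real (Suc m)" for m
  define T where "T N = (\<Sum>n\<le>N. u n * ln (real n))" for N :: nat
  define t where "t m = T (E m) - real m" for m
  have E_le: "real (E m) \<le> exp m" for m
    unfolding E_def by (simp add: of_nat_nat)
  have E_gt: "exp m < real (E m) + 1" for m
    unfolding E_def by (simp add: of_nat_nat)
  have E_mono: "E m \<le> E n" if "m \<le> n" for m n
    unfolding E_def by (intro nat_mono floor_mono) (use that in simp)
  have E_ge1: "E m \<ge> 1" for m using E_mono[of 0 m] by (simp add: E_def)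
  have E0: "E 0 = 1" by (simp add: E_def)
  have in_block: "real m < ln n \<and> ln n \<le> real m + 1" if "n \<in> {E m<..E (Suc m)}" for m n
  proof -
    have n: "real n > exp m" using that E_gt[of m] by auto
    moreover have "real n \<le> exp (real (Suc m))" using that E_le[of "Suc m"] by auto
    moreover have "real n > 0" using n less_trans[OF exp_gt_zero] by blast
    ultimately show ?thesis by (metis exp_less_cancel_iff exp_le_cancel_iff exp_ln of_nat_Suc add.commute)
  qed
  have atMost_split: "(\<Sum>n\<le>E (Suc m). h n) = (\<Sum>n\<le>E m. h n) + sum h {E m<..E (Suc m)}" for h :: "nat \<Rightarrow> real" and m
    using E_mono[of m "Suc m"] by (subst sum.union_disjoint[symmetric]) (auto intro!: sum.cong)
  \<comment> \<open>The arguments 0 and 1 lie in no block, because \<open>E 0 = 1\<close>; here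
    \<open>u 0 = u 1 = 0\<close> enters.\<close>
  have S_eq: "(\<Sum>n\<le>E M. u n) = (\<Sum>m<M. b m)" for M
  proof (induction M)
    case 0
    then show ?case using u01 by (simp add: E0)
  qed (simp add: atMost_split b_def)
  \<comment> \<open>Rounding costs at most 1: \<open>exp m < E m + 1 \<le> 2 * E m\<close> and
    \<open>2 \<le> exp 1\<close> give \<open>ln (E m) \<ge> m - 1\<close>.\<close>
  have t_bd: "\<bar>t m\<bar> \<le> C + 1" for m
  proof -
    have "ln (E m) \<le> m" using E_le[of m] E_ge1[of m] by (metis exp_le_cancel_iff exp_ln of_nat_0_less_iff less_le_trans zero_less_one)
    moreover have "ln (real (E m)) \<ge> real m - 1"
    proof -
      have "exp (real m - 1) = exp m / exp 1" by (simp add: exp_diff)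
      also have "\<dots> \<le> exp m / 2" using exp_ge_add_one_self[of 1] by (intro divide_left_mono) auto
      also have "\<dots> \<le> E m"
        using E_gt[of m] E_ge1[of m] by linarith
      finally show ?thesis using E_ge1[of m] by (subst ln_ge_iff) auto
    qed
    moreover have "\<bar>T (E m) - ln (E m)\<bar> \<le> C" unfolding T_def using log_bound[OF E_ge1] by simp
    ultimately show ?thesis unfolding t_def by linarith
  qed
  have T_diff: "T (E (Suc m)) - T (E m) = (\<Sum>n\<in>{E m<..E (Suc m)}. u n * ln n)" for m
    unfolding T_def by (simp add: atMost_split)
  have sum_c: "summable c"
  proof -
    \<comment> \<open>Partial summation: as \<open>t\<close> is bounded, it remains to control the error \<open>d m\<close> made by replacing \<open>ln n\<close>
      by \<open>m + 1\<close> on the \<open>m\<close>-th block.\<close>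
    define d where "d m = b m - (T (E (Suc m)) - T (E m)) / Suc m" for m
    \<comment> \<open>On the block, \<open>1 - ln n / (m + 2)\<close> lies between 0 and
      \<open>ln n * (1 / (m + 1) - 1 / (m + 2))\<close>. The constant \<open>2 * (C + 1) + 1\<close>
      bounds the increment of \<open>T\<close>. The shift to \<open>Suc m\<close> avoids division by
      0 on the first block.\<close>
    have d_bd: "\<bar>d (Suc m)\<bar> \<le> (2 * C + 3) / (real (Suc m) * real (Suc (Suc m)))" for m
    proof -
      let ?I = "{E (Suc m)<..E (Suc (Suc m))}"
      have d: "d (Suc m) = (\<Sum>n\<in>?I. u n * (1 - ln n / Suc (Suc m)))"
        unfolding d_def T_diff b_def by (simp add: sum_divide_distrib sum_subtractf[symmetric] algebra_simps)
      have "d (Suc m) \<ge> 0" unfolding d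
        by (intro sum_nonneg mult_nonneg_nonneg nonneg) (use in_block in force)
      moreover have "d (Suc m) \<le> (\<Sum>n\<in>?I. u n * ln n * (1 / Suc m - 1 / Suc (Suc m)))"
        unfolding d mult.assoc
      proof (intro sum_mono mult_left_mono nonneg)
        fix n assume "n \<in> ?I"
        then have "ln n \<ge> Suc m" using in_block by fastforce
        then have "1 \<le> ln n / Suc m" by simp
        then show "1 - ln n / Suc (Suc m) \<le> ln n * (1 / Suc m - 1 / Suc (Suc m))"
          by (simp add: algebra_simps)
      qed
      moreover have "(\<Sum>n\<in>?I. u n * ln n * (1 / Suc m - 1 / Suc (Suc m))) = (T (E (Suc (Suc m))) - T (E (Suc m))) * (1 / Suc m - 1 / Suc (Suc m))"
        unfolding T_diff sum_distrib_right ..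
      moreover have "\<dots> \<le> (2 * C + 3) * (1 / Suc m - 1 / Suc (Suc m))"
      proof (intro mult_right_mono)
        show "T (E (Suc (Suc m))) - T (E (Suc m)) \<le> 2 * C + 3"
          using t_bd[of "Suc m"] t_bd[of "Suc (Suc m)"] unfolding t_def by simp
      qed (simp add: field_simps)
      moreover have "1 / real (Suc m) - 1 / real (Suc (Suc m)) = 1 / (real (Suc m) * real (Suc (Suc m)))"
        by (simp add: field_simps)
      ultimately show ?thesis by (simp add: abs_if)
    qed
    have inv_sum: "summable (\<lambda>m. K / (real (Suc m) * real (Suc (Suc m))))" for K :: real
    proof -
      have "(\<lambda>m. K * (1 / real (Suc m) - 1 / real (Suc (Suc m)))) sums (K * (1 / real (Suc 0) - 0))"
        by (intro sums_mult telescope_sums') real_asymp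
      then have "summable (\<lambda>m. K * (1 / real (Suc m) - 1 / real (Suc (Suc m))))" by (rule sums_summable)
      moreover have "K * (1 / real (Suc m) - 1 / real (Suc (Suc m))) = K / (real (Suc m) * real (Suc (Suc m)))" for m
        by (simp add: field_simps)
      ultimately show ?thesis by (simp only:)
    qed
    have "summable (\<lambda>m. d (Suc m))"
      by (rule summable_comparison_test'[OF inv_sum[of "2 * C + 3"], of 0]) (use d_bd in auto)
    moreover have "summable (\<lambda>m. t (Suc m) / (real (Suc m) * real (Suc (Suc m))))"
      by (rule summable_comparison_test'[OF inv_sum[of "C + 1"], of 0])
         (use t_bd in \<open>auto intro!: divide_right_mono simp: abs_mult abs_divide\<close>)
    moreover have "summable (\<lambda>m. t (Suc (Suc m)) / Suc (Suc m) - t (Suc m) / Suc m)"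
    proof -
      have "(\<lambda>m. t m * (1 / real m)) \<longlonglongrightarrow> 0"
        by (intro lim_null_mult_left_bounded[of _ "C+1"] lim_1_over_n) (use t_bd in auto)
      then have "(\<lambda>m. t (Suc m) / Suc m) \<longlonglongrightarrow> 0"
        using LIMSEQ_Suc[of "\<lambda>m. t m * (1 / real m)"] by simp
      from telescope_sums[OF this] show ?thesis by (rule sums_summable)
    qed
    ultimately have "summable (\<lambda>m. d (Suc m) + t (Suc m) / (real (Suc m) * real (Suc (Suc m)))
        + (t (Suc (Suc m)) / Suc (Suc m) - t (Suc m) / Suc m))"
      by (intro summable_add)
    \<comment> \<open>The increment of \<open>T\<close> is 1 plus that of \<open>t\<close>. The
      latter, divided by \<open>m + 2\<close>, is a telescoping difference plus
      \<open>t (m + 1) / ((m + 1) * (m + 2))\<close>.\<close>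
    moreover have "d (Suc m) + t (Suc m) / (real (Suc m) * real (Suc (Suc m)))
        + (t (Suc (Suc m)) / Suc (Suc m) - t (Suc m) / Suc m) = c (Suc m)" for m
    proof -
      have T: "T (E k) = t k + k" for k by (simp add: t_def)
      have "B - ((t2 + (x + 1)) - (t1 + x)) / (x + 1) + t1 / (x * (x + 1)) + (t2 / (x + 1) - t1 / x) = B - 1 / (x + 1)"
        if "x > 0" for B t1 t2 x :: real
        using that by (simp add: divide_simps) (simp add: algebra_simps)
      from this[of "real (Suc m)" "b (Suc m)" "t (Suc (Suc m))" "t (Suc m)"] show ?thesis
        unfolding d_def c_def T by (simp add: add.commute)
    qed
    ultimately have "summable (\<lambda>m. c (Suc m))" by simp
    then show ?thesis by (simp add: summable_Suc_iff)
  qed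
  define F where "F \<epsilon> = (\<Sum>n. u n * real n powr -\<epsilon>)" for \<epsilon>
  define g where "g z = (\<Sum>m. b m * z ^ m)" for z :: real
  have b0: "b m \<ge> 0" for m unfolding b_def by (intro sum_nonneg nonneg)
  \<comment> \<open>With \<open>z = exp (-\<epsilon>)\<close>, the weight
    \<open>n powr -\<epsilon>\<close> lies between \<open>z ^ (m + 1)\<close> and
    \<open>z ^ m\<close> on block \<open>m\<close>, so the Dirichlet series and the power series
    \<open>g\<close> differ at most by a factor between \<open>z\<close> and 1.\<close>
  have g_props: "summable (\<lambda>m. b m * exp (-\<epsilon>) ^ m)" "exp (-\<epsilon>) * g (exp (-\<epsilon>)) \<le> F \<epsilon>" "F \<epsilon> \<le> g (exp (-\<epsilon>))"
    if \<epsilon>: "\<epsilon> > 0" for \<epsilon>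
  proof -
    define z where "z = exp (-\<epsilon>)"
    have z: "z > 0" "z < 1" using \<epsilon> by (auto simp: z_def)
    have zp: "z ^ m = exp (- \<epsilon> * m)" for m
      unfolding z_def by (simp add: exp_of_nat_mult[symmetric] mult.commute)
    have bl: "z * (b m * z ^ m) \<le> (\<Sum>n\<in>{E m<..E (Suc m)}. u n * real n powr -\<epsilon>)"
      "(\<Sum>n\<in>{E m<..E (Suc m)}. u n * real n powr -\<epsilon>) \<le> b m * z ^ m" for m
    proof -
      have "z ^ Suc m \<le> real n powr -\<epsilon> \<and> real n powr -\<epsilon> \<le> z ^ m" if "n \<in> {E m<..E (Suc m)}" for n
      proof -
        have "\<epsilon> * m \<le> \<epsilon> * ln n" "\<epsilon> * ln n \<le> \<epsilon> * (real m + 1)"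
          using in_block[OF that] \<epsilon> by (auto intro: mult_left_mono)
        then show ?thesis
          unfolding zp powr_def using that by (auto simp: algebra_simps)
      qed
      then have *: "u n * z ^ Suc m \<le> u n * real n powr -\<epsilon> \<and> u n * real n powr -\<epsilon> \<le> u n * z ^ m"
        if "n \<in> {E m<..E (Suc m)}" for n
        using that nonneg[of n] by (simp add: mult_left_mono)
      have "z * (b m * z ^ m) = (\<Sum>n\<in>{E m<..E (Suc m)}. u n * z ^ Suc m)"
        unfolding b_def sum_distrib_left sum_distrib_right by (simp add: mult_ac)
      also have "\<dots> \<le> (\<Sum>n\<in>{E m<..E (Suc m)}. u n * real n powr -\<epsilon>)"
        by (rule sum_mono) (use * in blast)
      finally show "z * (b m * z ^ m) \<le> (\<Sum>n\<in>{E m<..E (Suc m)}. u n * real n powr -\<epsilon>)" .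
      show "(\<Sum>n\<in>{E m<..E (Suc m)}. u n * real n powr -\<epsilon>) \<le> b m * z ^ m"
        unfolding b_def sum_distrib_right by (rule sum_mono) (use * in blast)
    qed
    have part: "z * (\<Sum>m<M. b m * z ^ m) \<le> (\<Sum>n\<le>E M. u n * real n powr -\<epsilon>)"
      "(\<Sum>n\<le>E M. u n * real n powr -\<epsilon>) \<le> (\<Sum>m<M. b m * z ^ m)" for M
    proof (induction M)
      case 0
      {
        case 1 show ?case using u01 by (simp add: E0)
      next
        case 2 show ?case using u01 by (simp add: E0)
      }
    next
      case (Suc M)
      {
        case 1 show ?case using Suc(1) bl(1)[of M] by (simp add: atMost_split distrib_left)
      next
        case 2 show ?case using Suc(2) bl(2)[of M] by (simp add: atMost_split)
      }
    qed
    have F_ge: "(\<Sum>n\<le>E M. u n * real n powr -\<epsilon>) \<le> F \<epsilon>" for M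
      unfolding F_def by (intro sum_le_suminf summ \<epsilon>) (auto intro: mult_nonneg_nonneg nonneg)
    have s: "summable (\<lambda>m. b m * z ^ m)"
    proof (rule bounded_imp_summable)
      show "b m * z ^ m \<ge> 0" for m using b0 z by simp
      show "(\<Sum>m\<le>n. b m * z ^ m) \<le> F \<epsilon> / z" for n
        using order_trans[OF part(1) F_ge, of "Suc n"] z
        by (simp add: lessThan_Suc_atMost field_simps)
    qed
    then show "summable (\<lambda>m. b m * exp (-\<epsilon>) ^ m)" by (simp add: z_def)
    have lg: "(\<lambda>M. \<Sum>m<M. b m * z ^ m) \<longlonglongrightarrow> g z"
      unfolding g_def using summable_LIMSEQ[OF s] .
    have "(\<lambda>N. \<Sum>n\<le>N. u n * real n powr -\<epsilon>) \<longlonglongrightarrow> F \<epsilon>"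
      unfolding F_def using summable_LIMSEQ'[OF summ[OF \<epsilon>]] .
    moreover have "filterlim E at_top at_top"
      unfolding E_def by (intro filterlim_compose[OF filterlim_nat_sequentially] filterlim_compose[OF filterlim_floor_sequentially]) real_asymp
    ultimately have lF: "(\<lambda>M. \<Sum>n\<le>E M. u n * real n powr -\<epsilon>) \<longlonglongrightarrow> F \<epsilon>"
      by (rule filterlim_compose)
    show "exp (-\<epsilon>) * g (exp (-\<epsilon>)) \<le> F \<epsilon>"
      unfolding z_def[symmetric]
      by (rule LIMSEQ_le[OF tendsto_mult_left[OF lg] lF]) (use part in blast)
    show "F \<epsilon> \<le> g (exp (-\<epsilon>))"
      unfolding z_def[symmetric]
      by (rule LIMSEQ_le[OF lF lg]) (use part in blast)
  qed
  have ep: "\<forall>\<^sub>F \<epsilon> in at_right (0::real). \<epsilon> > 0" by (simp add: eventually_at_right_less)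
  have limF: "((\<lambda>\<epsilon>. F \<epsilon> + ln \<epsilon>) \<longlongrightarrow> 0) (at_right 0)" unfolding F_def by (rule lim)
  have limg: "((\<lambda>\<epsilon>. g (exp (-\<epsilon>)) + ln \<epsilon>) \<longlongrightarrow> 0) (at_right 0)"
  proof (rule tendsto_sandwich)
    show "((\<lambda>\<epsilon>. F \<epsilon> + ln \<epsilon>) \<longlongrightarrow> 0) (at_right 0)" by (rule limF)
    show "\<forall>\<^sub>F \<epsilon> in at_right 0. F \<epsilon> + ln \<epsilon> \<le> g (exp (-\<epsilon>)) + ln \<epsilon>"
      using ep by eventually_elim (use g_props in auto)
    show "\<forall>\<^sub>F \<epsilon> in at_right 0. g (exp (-\<epsilon>)) + ln \<epsilon> \<le> exp \<epsilon> * (F \<epsilon> + ln \<epsilon>) + (1 - exp \<epsilon>) * ln \<epsilon>"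
      using ep
    proof eventually_elim
      case (elim \<epsilon>)
      from g_props(2)[OF elim] have "g (exp (-\<epsilon>)) \<le> exp \<epsilon> * F \<epsilon>"
        by (simp add: exp_minus field_simps)
      then show ?case by (simp add: algebra_simps)
    qed
    \<comment> \<open>The upper bound is
      \<open>exp \<epsilon> * F \<epsilon> + ln \<epsilon>\<close>, regrouped so that both summands
      tend to 0: \<open>1 - exp \<epsilon>\<close> outweighs \<open>ln \<epsilon>\<close>.\<close>
    have "((\<lambda>\<epsilon>::real. exp \<epsilon>) \<longlongrightarrow> 1) (at_right 0)" by real_asymp
    moreover have "((\<lambda>\<epsilon>::real. (1 - exp \<epsilon>) * ln \<epsilon>) \<longlongrightarrow> 0) (at_right 0)" by real_asymp
    ultimately show "((\<lambda>\<epsilon>. exp \<epsilon> * (F \<epsilon> + ln \<epsilon>) + (1 - exp \<epsilon>) * ln \<epsilon>) \<longlongrightarrow> 0) (at_right 0)"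
      using tendsto_add[OF tendsto_mult[OF _ limF]] by force
  qed
  \<comment> \<open>The terms \<open>1 / (m + 1)\<close> contribute \<open>- ln (1 - z) / z\<close>,
    the logarithmic series with one power of \<open>z\<close> divided out; \<open>1 / z\<close> is
    \<open>exp \<epsilon>\<close>.\<close>
  have c_eq: "(\<Sum>m. c m * exp (-\<epsilon>) ^ m) = g (exp (-\<epsilon>)) + exp \<epsilon> * ln (1 - exp (-\<epsilon>))" if \<epsilon>: "\<epsilon> > 0" for \<epsilon>
  proof -
    define z where "z = exp (-\<epsilon>)"
    have z: "z > 0" "z < 1" using \<epsilon> by (auto simp: z_def)
    have "ln (1 - z) = (\<Sum>n. (-1) ^ n * (1 / real (n + 1)) * ((1 - z) - 1) ^ Suc n)"
      by (rule ln_series) (use z in auto)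
    moreover have "(-1) ^ n * (1 / real (n + 1)) * ((1 - z) - 1) ^ Suc n = -z * (z ^ n / Suc n)" for n
    proof -
      have "(-1) ^ n * (-z) ^ n = z ^ n" by (simp flip: power_mult_distrib)
      moreover have "(-1) ^ n * (1 / real (n + 1)) * ((1 - z) - 1) ^ Suc n = -z * (((-1) ^ n * (-z) ^ n) / Suc n)"
        by simp
      ultimately show ?thesis by simp
    qed
    moreover have s1: "summable (\<lambda>n. z ^ n / Suc n)"
    proof (rule summable_comparison_test'[of "\<lambda>n. z ^ n" 0])
      show "norm (z ^ n / Suc n) \<le> z ^ n" for n
        using divide_left_mono[of 1 "real (Suc n)" "z ^ n"] z by simp
    qed (use z in auto)
    ultimately have "ln (1 - z) = - z * (\<Sum>n. z ^ n / Suc n)"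
      by (simp only: suminf_mult)
    then have "(\<Sum>n. z ^ n / Suc n) = - exp \<epsilon> * ln (1 - z)"
      using z by (simp add: z_def exp_minus field_simps)
    moreover have "(\<Sum>m. c m * z ^ m) = g z - (\<Sum>n. z ^ n / Suc n)"
      unfolding g_def c_def
      by (subst suminf_diff) (use s1 g_props(1)[OF \<epsilon>] in \<open>auto simp: z_def algebra_simps\<close>)
    ultimately show ?thesis by (simp add: z_def)
  qed
  have "((\<lambda>\<epsilon>. \<Sum>m. c m * exp (-\<epsilon>) ^ m) \<longlongrightarrow> 0) (at_right 0)"
  proof (rule Lim_transform_eventually)
    have "((\<lambda>\<epsilon>::real. exp \<epsilon> * ln (1 - exp (-\<epsilon>)) - ln \<epsilon>) \<longlongrightarrow> 0) (at_right 0)" by real_asymp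
    from tendsto_add[OF limg this]
    show "((\<lambda>\<epsilon>. g (exp (-\<epsilon>)) + ln \<epsilon> + (exp \<epsilon> * ln (1 - exp (-\<epsilon>)) - ln \<epsilon>)) \<longlongrightarrow> 0) (at_right 0)" by simp
    show "\<forall>\<^sub>F \<epsilon> in at_right 0. g (exp (-\<epsilon>)) + ln \<epsilon> + (exp \<epsilon> * ln (1 - exp (-\<epsilon>)) - ln \<epsilon>) = (\<Sum>m. c m * exp (-\<epsilon>) ^ m)"
      using ep by eventually_elim (simp add: c_eq)
  qed
  \<comment> \<open>Abel's theorem evaluates the same limit a second time, so the sum of
    \<open>c\<close> has to be 0.\<close>
  moreover have "((\<lambda>\<epsilon>. \<Sum>m. c m * exp (-\<epsilon>) ^ m) \<longlongrightarrow> suminf c) (at_right 0)"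
  proof (rule filterlim_compose[OF Abel_limit[OF sum_c]])
    show "filterlim (\<lambda>\<epsilon>. exp (- \<epsilon>)) (at_left 1) (at_right (0::real))" by real_asymp
  qed
  ultimately have c_zero: "suminf c = 0" by (rule tendsto_unique[rotated, THEN sym]) auto
  have limE: "(\<lambda>M. (\<Sum>n\<le>E M. u n) - ln M) \<longlonglongrightarrow> euler_mascheroni"
  proof -
    have "(\<lambda>M. \<Sum>m<M. c m) \<longlonglongrightarrow> 0" using summable_LIMSEQ[OF sum_c] c_zero by simp
    moreover have "(\<Sum>m<M. c m) = (\<Sum>n\<le>E M. u n) - harm M" for M
      unfolding S_eq c_def by (induction M) (auto simp: harm_Suc inverse_eq_divide harm_def)
    ultimately have "(\<lambda>M. (\<Sum>n\<le>E M. u n) - harm M) \<longlonglongrightarrow> 0" by simp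
    from tendsto_add[OF this euler_mascheroni_LIMSEQ] show ?thesis by simp
  qed
  \<comment> \<open>A general \<open>x\<close> lies between two consecutive cut points. The sums are
    monotone, and \<open>ln (fl x)\<close> and \<open>ln (fl x + 1)\<close> both differ from
    \<open>ln (ln x)\<close> by \<open>o(1)\<close>.\<close>
  define fl where "fl x = nat \<lfloor>ln x\<rfloor>" for x :: real
  have fl: "filterlim fl at_top at_top"
    unfolding fl_def by (intro filterlim_compose[OF filterlim_nat_sequentially] filterlim_compose[OF filterlim_floor_sequentially]) real_asymp
  show ?thesis
  proof (rule tendsto_sandwich)
    have big: "\<forall>\<^sub>F x in at_top. x \<ge> exp (1::real)" by (rule eventually_ge_at_top)
    have flb: "real (fl x) \<le> ln x \<and> ln x \<le> real (Suc (fl x)) \<and> fl x \<ge> 1" if "x \<ge> exp 1" for x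
    proof -
      have "x > 0" using that less_le_trans[OF exp_gt_zero] by blast
      then have "ln x \<ge> 1" using that by (metis exp_le_cancel_iff exp_ln)
      then show ?thesis unfolding fl_def by (auto simp: le_nat_iff le_floor_iff) linarith+
    qed
    show "\<forall>\<^sub>F x in at_top. ((\<Sum>n\<le>E (fl x). u n) - ln (fl x)) + (ln (fl x) - ln (ln x)) \<le> (\<Sum>n\<le>nat \<lfloor>x\<rfloor>. u n) - ln (ln x)"
      using big
    proof eventually_elim
      case (elim x)
      then have x0: "x > 0" using less_le_trans[OF exp_gt_zero] by blast
      have "exp (real (fl x)) \<le> x" using flb[OF elim] x0 by (metis exp_le_cancel_iff exp_ln)
      then have "E (fl x) \<le> nat \<lfloor>x\<rfloor>" unfolding E_def by (intro nat_mono floor_mono)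
      then have "(\<Sum>n\<le>E (fl x). u n) \<le> (\<Sum>n\<le>nat \<lfloor>x\<rfloor>. u n)" by (intro sum_mono2 nonneg) auto
      then show ?case by simp
    qed
    show "\<forall>\<^sub>F x in at_top. (\<Sum>n\<le>nat \<lfloor>x\<rfloor>. u n) - ln (ln x) \<le> ((\<Sum>n\<le>E (Suc (fl x)). u n) - ln (Suc (fl x))) + (ln (Suc (fl x)) - ln (ln x))"
      using big
    proof eventually_elim
      case (elim x)
      then have x0: "x > 0" using less_le_trans[OF exp_gt_zero] by blast
      have "x \<le> exp (real (Suc (fl x)))" using flb[OF elim] x0 by (metis exp_le_cancel_iff exp_ln)
      then have "nat \<lfloor>x\<rfloor> \<le> E (Suc (fl x))" unfolding E_def by (intro nat_mono floor_mono)
      then have "(\<Sum>n\<le>nat \<lfloor>x\<rfloor>. u n) \<le> (\<Sum>n\<le>E (Suc (fl x)). u n)" by (intro sum_mono2 nonneg) auto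
      then show ?case by simp
    qed
    have l1: "((\<lambda>x. ln (fl x) - ln (ln x)) \<longlongrightarrow> 0) at_top"
    proof -
      have "((\<lambda>x::real. ln (real_of_int \<lfloor>ln x\<rfloor>) - ln (ln x)) \<longlongrightarrow> 0) at_top" by real_asymp
      moreover have "\<forall>\<^sub>F x in at_top. ln (real_of_int \<lfloor>ln x\<rfloor>) - ln (ln x) = ln (fl x) - ln (ln (x::real))"
        using eventually_ge_at_top[of "1::real"] by eventually_elim (simp add: fl_def)
      ultimately show ?thesis by (rule Lim_transform_eventually)
    qed
    have l2: "((\<lambda>x. ln (Suc (fl x)) - ln (ln x)) \<longlongrightarrow> 0) at_top"
    proof -
      have "((\<lambda>x::real. ln (real_of_int \<lfloor>ln x\<rfloor> + 1) - ln (ln x)) \<longlongrightarrow> 0) at_top" by real_asymp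
      moreover have "\<forall>\<^sub>F x in at_top. ln (real_of_int \<lfloor>ln x\<rfloor> + 1) - ln (ln x) = ln (Suc (fl x)) - ln (ln (x::real))"
        using eventually_ge_at_top[of "1::real"] by eventually_elim (simp add: fl_def add.commute)
      ultimately show ?thesis by (rule Lim_transform_eventually)
    qed
    show "((\<lambda>x. ((\<Sum>n\<le>E (fl x). u n) - ln (fl x)) + (ln (fl x) - ln (ln x))) \<longlongrightarrow> euler_mascheroni) at_top"
      using tendsto_add[OF filterlim_compose[OF limE fl] l1] by simp
    show "((\<lambda>x. ((\<Sum>n\<le>E (Suc (fl x)). u n) - ln (Suc (fl x))) + (ln (Suc (fl x)) - ln (ln x))) \<longlongrightarrow> euler_mascheroni) at_top"
      using tendsto_add[OF filterlim_compose[OF LIMSEQ_Suc[OF limE] fl] l2] by simp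
  qed
qed

section \<open>Mertens' first theorem\<close>

lemma finite_primes_le: "finite {p. prime p \<and> p \<le> (n::nat)}"
  by (rule finite_subset[of _ "{..n}"]) auto

section \<open>Chebyshev's upper bound\<close>

lemma prod_primes_dvd:
  fixes m :: nat
  assumes "finite A" "\<And>p. p \<in> A \<Longrightarrow> prime p" "\<And>p. p \<in> A \<Longrightarrow> p dvd m"
  shows "\<Prod>A dvd m"
  using assms
proof (induction A rule: finite_induct)
  case (insert p A)
  have "coprime p (\<Prod>A)"
    by (rule prod_coprime_right) (use insert in \<open>auto intro!: primes_coprime\<close>)
  with insert show ?case by (auto intro!: divides_mult)
qed auto

text \<open>Erdos' induction. An even \<open>n > 2\<close> is not prime and reduces to
  \<open>n - 1\<close>. For \<open>n = 2 * m + 1\<close> the primes in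
  \<open>(m + 1, 2 * m + 1]\<close> divide \<open>(2 * m + 1) choose m\<close>, which is at most
  \<open>4 ^ m\<close>; the primes up to \<open>m + 1\<close> are left to the induction.\<close>

lemma primorial_le: "\<Prod>{p. prime p \<and> p \<le> n} \<le> 4 ^ (n::nat)"
proof (induction n rule: less_induct)
  case (less n)
  consider "n \<le> 1" | "n = 2" | "n > 2" "even n" | m where "n = 2 * m + 1" "m > 0"
  proof (cases "even n")
    case True
    then show ?thesis using that by (cases "n = 2"; cases "n = 0"; fastforce)
  next
    case False
    then obtain m where "n = 2 * m + 1" by (rule oddE)
    then show ?thesis using that(1) that(4)[of m] by (cases "m = 0") auto
  qed
  then show ?case
  proof cases
    case 1
    then have *: "{p. prime p \<and> p \<le> n} = {}" by (auto dest: prime_gt_1_nat)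
    show ?thesis unfolding * by simp
  next
    case 2
    have "{p. prime p \<and> p \<le> (2::nat)} = {2}" by (auto dest: prime_ge_2_nat)
    then show ?thesis by (simp add: 2)
  next
    case 3
    have "{p. prime p \<and> p \<le> n} = {p. prime p \<and> p \<le> n - 1}"
      using 3 prime_odd_nat[of n] by (auto simp: le_less)
    then have "\<Prod>{p. prime p \<and> p \<le> n} \<le> 4 ^ (n - 1)" using less[of "n - 1"] 3 by simp
    also have "\<dots> \<le> 4 ^ n" by (rule power_increasing) auto
    finally show ?thesis .
  next
    case 4
    define A where "A = {p. prime p \<and> p \<le> m + 1}"
    define B where "B = {p. prime p \<and> m + 1 < p \<and> p \<le> 2 * m + 1}"
    have fin: "finite A" "finite B" unfolding A_def B_def
      by (auto intro: finite_subset[of _ "{..2 * m + 1}"])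
    have AB: "{p. prime p \<and> p \<le> n} = A \<union> B" "A \<inter> B = {}"
      unfolding A_def B_def using 4 by auto
    have "\<Prod>B dvd (2 * m + 1) choose m"
    proof (rule prod_primes_dvd[OF fin(2)])
      fix p assume p: "p \<in> B"
      then have pr: "prime p" and gt: "m + 1 < p" "p \<le> 2 * m + 1" by (auto simp: B_def)
      have "fact m * fact (2 * m + 1 - m) * ((2 * m + 1) choose m) = (fact (2 * m + 1) :: nat)"
        by (rule binomial_fact_lemma) simp
      moreover have "p dvd fact (2 * m + 1)" using pr gt by (simp only: prime_dvd_fact_iff)
      moreover have "\<not> p dvd fact m" "\<not> p dvd fact (2 * m + 1 - m)"
        using pr gt by (simp_all only: prime_dvd_fact_iff)
      ultimately show "p dvd (2 * m + 1) choose m" using pr by (metis prime_dvd_mult_iff)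
    qed (auto simp: B_def)
    then have "\<Prod>B \<le> (2 * m + 1) choose m" by (rule dvd_imp_le) simp
    also have "\<dots> \<le> 4 ^ m"
    proof -
      \<comment> \<open>The two equal middle entries of an odd row together are at most the row
        sum.\<close>
      have "2 * ((2 * m + 1) choose m) = ((2 * m + 1) choose m) + ((2 * m + 1) choose (m + 1))"
        using binomial_symmetric[of m "2 * m + 1"] by simp
      also have "\<dots> = (\<Sum>k\<in>{m, m + 1}. (2 * m + 1) choose k)" by simp
      also have "\<dots> \<le> (\<Sum>k\<le>2 * m + 1. (2 * m + 1) choose k)" by (rule sum_mono2) auto
      also have "\<dots> = 2 ^ (2 * m + 1)" by (rule choose_row_sum)
      also have "\<dots> = 2 * 4 ^ m" by (simp add: power_mult)
      finally show ?thesis by simp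
    qed
    finally have B: "\<Prod>B \<le> 4 ^ m" .
    have "\<Prod>A \<le> 4 ^ (m + 1)" unfolding A_def using less[of "m + 1"] 4 by simp
    then have "\<Prod>(A \<union> B) \<le> 4 ^ (m + 1) * 4 ^ m"
      using B AB fin by (simp add: prod.union_disjoint mult_mono del: power_Suc)
    also have "\<dots> = 4 ^ n" using 4 by (simp flip: power_add)
    finally show ?thesis by (simp add: AB)
  qed
qed

lemma chebyshev_theta_le: "(\<Sum>p | prime p \<and> p \<le> n. ln (real p)) \<le> real n * ln 4"
proof -
  have "(\<Sum>p | prime p \<and> p \<le> n. ln (real p)) = ln (real (\<Prod>{p. prime p \<and> p \<le> n}))"
    by (subst of_nat_prod, subst ln_prod[symmetric]) (auto simp: finite_primes_le dest: prime_gt_0_nat)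
  also have "\<dots> \<le> ln (real (4 ^ n))"
  proof -
    have "real (\<Prod>{p. prime p \<and> p \<le> n}) \<le> real (4 ^ n)" using primorial_le by (rule of_nat_mono)
    moreover have "real (\<Prod>{p. prime p \<and> p \<le> n}) > 0" by (auto intro!: prod_pos dest: prime_gt_0_nat)
    ultimately show ?thesis by simp
  qed
  also have "\<dots> = real n * ln 4" by (simp add: ln_realpow)
  finally show ?thesis .
qed

section \<open>Legendre's formula and the sums of ln p / p and ln p / (p - 1)\<close>

lemma card_multiples_le:
  assumes "d > 0"
  shows "card {k \<in> {1..n}. d dvd k} = n div (d::nat)"
proof -
  have "bij_betw (\<lambda>j. d * j) {1..n div d} {k \<in> {1..n}. d dvd k}"
    by (rule bij_betwI[where g = "\<lambda>k. k div d"])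
       (use assms in \<open>auto simp: less_eq_div_iff_mult_less_eq mult.commute div_le_mono elim!: dvdE\<close>)
  then show ?thesis by (simp add: bij_betw_same_card[symmetric])
qed

text \<open>The multiplicity of \<open>p\<close> is counted as the number of \<open>j\<close> with
  \<open>p ^ j dvd k\<close>. Ranges for \<open>p\<close> and \<open>j\<close> that do not depend on
  \<open>k\<close> prepare the interchange of sums; they are long enough because
  \<open>multiplicity p k < p ^ multiplicity p k \<le> k\<close>.\<close>

lemma ln_eq_sum_prime_powers:
  assumes k: "1 \<le> k" "k \<le> n"
  shows "ln (real k) = (\<Sum>p | prime p \<and> p \<le> n. \<Sum>j=1..n. if p ^ j dvd k then ln (real p) else 0)"
proof -
  have "real k = real (\<Prod>p\<in>prime_factors k. p ^ multiplicity p k)"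
    using k prime_factorization_nat[of k] by simp
  then have "ln (real k) = (\<Sum>p\<in>prime_factors k. real (multiplicity p k) * ln (real p))"
    by (simp only: of_nat_prod of_nat_power, subst ln_prod)
       (auto simp: ln_realpow prime_gt_0_nat in_prime_factors_iff)
  also have "\<dots> = (\<Sum>p | prime p \<and> p \<le> n. real (multiplicity p k) * ln (real p))"
  proof (rule sum.mono_neutral_left)
    show "prime_factors k \<subseteq> {p. prime p \<and> p \<le> n}"
      using k by (auto simp: in_prime_factors_iff dest!: dvd_imp_le)
    show "\<forall>p\<in>{p. prime p \<and> p \<le> n} - prime_factors k. real (multiplicity p k) * ln (real p) = 0"
      using k by (auto simp: in_prime_factors_iff not_dvd_imp_multiplicity_0)
  qed (rule finite_primes_le)
  also have "\<dots> = (\<Sum>p | prime p \<and> p \<le> n. \<Sum>j=1..n. if p ^ j dvd k then ln (real p) else 0)"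
  proof (rule sum.cong)
    fix p assume "p \<in> {p. prime p \<and> p \<le> n}"
    then have p: "prime p" by simp
    have "p ^ multiplicity p k \<le> k" using k by (intro dvd_imp_le multiplicity_dvd) auto
    moreover have "multiplicity p k < p ^ multiplicity p k"
      using p by (intro power_gt_expt prime_gt_Suc_0_nat)
    ultimately have le: "multiplicity p k \<le> n" using k by linarith
    have iff: "p ^ j dvd k \<longleftrightarrow> j \<le> multiplicity p k" for j
      using p k by (intro power_dvd_iff_le_multiplicity) (auto dest: prime_gt_1_nat)
    have "{j \<in> {1..n}. p ^ j dvd k} = {j \<in> {1..n}. j \<le> multiplicity p k}" by (simp only: iff)
    also have "\<dots> = {1..multiplicity p k}" using le by (auto intro: order_trans)
    finally show "real (multiplicity p k) * ln (real p) = (\<Sum>j=1..n. if p ^ j dvd k then ln (real p) else 0)"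
      by (simp add: sum.If_cases Int_def)
  qed simp
  finally show ?thesis .
qed

text \<open>Legendre's formula: after summation over \<open>k\<close> and interchange, the multiples
  of \<open>p ^ j\<close> up to \<open>n\<close> remain to be counted.\<close>

lemma ln_fact_eq_sum_primes:
  "ln (fact n :: real) = (\<Sum>p | prime p \<and> p \<le> n. ln (real p) * (\<Sum>j=1..n. real (n div p ^ j)))"
proof -
  have "ln (fact n :: real) = (\<Sum>k=1..n. ln (real k))"
    by (induction n) (auto simp: ln_mult)
  also have "\<dots> = (\<Sum>k=1..n. \<Sum>p | prime p \<and> p \<le> n. \<Sum>j=1..n. if p ^ j dvd k then ln (real p) else 0)"
    by (intro sum.cong ln_eq_sum_prime_powers) auto
  also have "\<dots> = (\<Sum>p | prime p \<and> p \<le> n. \<Sum>j=1..n. \<Sum>k=1..n. if p ^ j dvd k then ln (real p) else 0)"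
    by (subst sum.swap) (intro sum.cong refl sum.swap)
  also have "\<dots> = (\<Sum>p | prime p \<and> p \<le> n. ln (real p) * (\<Sum>j=1..n. real (n div p ^ j)))"
  proof (intro sum.cong refl)
    fix p assume "p \<in> {p. prime p \<and> p \<le> n}"
    then have p: "p > 0" by (auto dest: prime_gt_0_nat)
    have "(\<Sum>k=1..n. if p ^ j dvd k then ln (real p) else 0) = ln (real p) * real (n div p ^ j)" for j
      using card_multiples_le[of "p ^ j" n] p by (simp add: sum.If_cases Int_def)
    then show "(\<Sum>j=1..n. \<Sum>k=1..n. if p ^ j dvd k then ln (real p) else 0) = ln (real p) * (\<Sum>j=1..n. real (n div p ^ j))"
      by (simp add: sum_distrib_left)
  qed
  finally show ?thesis .
qed

text \<open>In Legendre's formula only \<open>j = 1\<close> is kept, and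
  \<open>fact n \<le> n ^ n\<close>. Rounding in \<open>n div p\<close> costs Chebyshev's sum of
  \<open>ln p\<close>, whence the constant \<open>ln 4\<close>.\<close>

lemma sum_ln_prime_over_le:
  assumes n: "n \<ge> 1"
  shows "(\<Sum>p | prime p \<and> p \<le> n. ln (real p) / real p) \<le> ln (real n) + ln 4"
proof -
  have "real n * (\<Sum>p | prime p \<and> p \<le> n. ln (real p) / real p) - (\<Sum>p | prime p \<and> p \<le> n. ln (real p))
     = (\<Sum>p | prime p \<and> p \<le> n. ln (real p) * (real n / real p - 1))"
    by (simp add: sum_distrib_left sum_subtractf[symmetric] algebra_simps)
  also have "\<dots> \<le> (\<Sum>p | prime p \<and> p \<le> n. ln (real p) * (\<Sum>j=1..n. real (n div p ^ j)))"
  proof (intro sum_mono mult_left_mono)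
    fix p assume "p \<in> {p. prime p \<and> p \<le> n}"
    then have p: "p > 1" by (auto dest: prime_gt_1_nat)
    show "ln (real p) \<ge> 0" using p by simp
    have "real n / real p - 1 \<le> real (n div p)"
      using floor_divide_of_nat_eq[of n p, where ?'a = real] by linarith
    also have "\<dots> = (\<Sum>j\<in>{1}. real (n div p ^ j))" by simp
    also have "\<dots> \<le> (\<Sum>j=1..n. real (n div p ^ j))" using n by (intro sum_mono2) auto
    finally show "real n / real p - 1 \<le> (\<Sum>j=1..n. real (n div p ^ j))" .
  qed
  also have "\<dots> = ln (fact n)" by (rule ln_fact_eq_sum_primes[symmetric])
  also have "\<dots> \<le> ln (real (n ^ n))"
  proof -
    have "(fact n :: nat) \<le> n ^ n" using fact_le_power[of n, where ?'a = nat] by simp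
    then have "real (fact n) \<le> real (n ^ n)" by (rule of_nat_mono)
    then show ?thesis by (subst ln_le_cancel_iff) (use n in auto)
  qed
  also have "\<dots> = real n * ln (real n)" using n by (simp add: ln_realpow)
  finally have "real n * (\<Sum>p | prime p \<and> p \<le> n. ln (real p) / real p) \<le> real n * (ln (real n) + ln 4)"
    using chebyshev_theta_le[of n] by (simp add: algebra_simps)
  then show ?thesis using n by simp
qed

text \<open>Here all powers of \<open>p\<close> are kept and the rounding is dropped; the geometric
  series over \<open>j\<close> produces \<open>1 / (p - 1)\<close>. A single term of the exponential
  series shows \<open>ln (fact n) \<ge> n * ln n - n\<close>.\<close>

lemma sum_ln_prime_over_ge:
  assumes n: "n \<ge> 1"
  shows "(\<Sum>p | prime p \<and> p \<le> n. ln (real p) / (real p - 1)) \<ge> ln (real n) - 1"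
proof -
  have "real n * ln (real n) - real n \<le> ln (fact n)"
  proof -
    have "real n ^ n / fact n \<le> exp (real n)"
    proof -
      have "(\<Sum>k\<in>{n}. inverse (fact k) * real n ^ k) \<le> (\<Sum>k. inverse (fact k) * real n ^ k)"
        by (rule sum_le_suminf) (auto intro: summable_exp simp: mult.commute)
      then show ?thesis by (simp add: exp_def divide_inverse mult.commute)
    qed
    then have "ln (real n ^ n / fact n) \<le> ln (exp (real n))" using n by (subst ln_le_cancel_iff) auto
    then show ?thesis using n by (simp add: ln_div ln_realpow)
  qed
  also have "\<dots> = (\<Sum>p | prime p \<and> p \<le> n. ln (real p) * (\<Sum>j=1..n. real (n div p ^ j)))"
    by (rule ln_fact_eq_sum_primes)
  also have "\<dots> \<le> (\<Sum>p | prime p \<and> p \<le> n. ln (real p) * (real n / (real p - 1)))"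
  proof (intro sum_mono mult_left_mono)
    fix p assume "p \<in> {p. prime p \<and> p \<le> n}"
    then have p: "p > 1" by (auto dest: prime_gt_1_nat)
    show "ln (real p) \<ge> 0" using p by simp
    have geo: "(\<Sum>j=1..N. 1 / real p ^ j) = (1 - 1 / real p ^ N) / (real p - 1)" for N
    proof (induction N)
      case (Suc N)
      have "(1 - 1 / real p ^ N) / (real p - 1) + 1 / real p ^ Suc N = (1 - 1 / real p ^ Suc N) / (real p - 1)"
        using p by (simp add: divide_simps) (simp add: algebra_simps)
      with Suc show ?case by simp
    qed simp
    have "(\<Sum>j=1..n. real (n div p ^ j)) \<le> (\<Sum>j=1..n. real n * (1 / real p ^ j))"
      by (intro sum_mono) (use of_nat_div_le_of_nat in \<open>simp flip: of_nat_power\<close>)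
    also have "\<dots> = real n * ((1 - 1 / real p ^ n) / (real p - 1))"
      by (simp only: geo flip: sum_distrib_left)
    also have "\<dots> \<le> real n * (1 / (real p - 1))"
      using p by (intro mult_left_mono divide_right_mono) auto
    finally show "(\<Sum>j=1..n. real (n div p ^ j)) \<le> real n / (real p - 1)" by simp
  qed
  also have "\<dots> = real n * (\<Sum>p | prime p \<and> p \<le> n. ln (real p) / (real p - 1))"
    by (simp add: sum_distrib_left mult_ac)
  finally have "real n * (ln (real n) - 1) \<le> real n * (\<Sum>p | prime p \<and> p \<le> n. ln (real p) / (real p - 1))"
    by (simp add: algebra_simps)
  then show ?thesis using n by simp
qed

lemma prime_weight_bounds:
  fixes x :: real
  assumes "x \<ge> 2"
  shows "1 / x \<le> - ln (1 - 1 / x)" "- ln (1 - 1 / x) \<le> 1 / (x - 1)"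
proof -
  have *: "1 - 1 / x > 0" using assms by simp
  show "1 / x \<le> - ln (1 - 1 / x)" using ln_le_minus_one[OF *] by simp
  have "- ln (1 - 1 / x) = ln (x / (x - 1))" using assms by (simp add: ln_div[symmetric] field_simps flip: ln_inverse)
  also have "\<dots> \<le> x / (x - 1) - 1" using assms by (intro ln_le_minus_one) auto
  also have "\<dots> = 1 / (x - 1)" using assms by (simp add: field_simps)
  finally show "- ln (1 - 1 / x) \<le> 1 / (x - 1)" .
qed

text \<open>From \<open>ln k \<le> 2 * k powr (1/2)\<close>. This majorant serves twice: for the gap
  between \<open>1 / p\<close> and \<open>1 / (p - 1)\<close>, and for the comparison of the prime
  series with \<open>ln (\<zeta>(1 + \<epsilon>))\<close>.\<close>

lemma summable_ln_over_square: "summable (\<lambda>k::nat. ln (real k) * (2 / real k ^ 2))"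
proof (rule summable_comparison_test_ev)
  show "\<forall>\<^sub>F k in sequentially. norm (ln (real k) * (2 / real k ^ 2)) \<le> 4 * real k powr -(3/2)"
    using eventually_ge_at_top[of 1]
  proof eventually_elim
    case (elim k)
    have "ln (real k) = 2 * ln (real k powr (1/2))" using elim by (simp add: ln_powr)
    also have "\<dots> \<le> 2 * real k powr (1/2)" using elim ln_bound[of "real k powr (1/2)"] by simp
    finally have "ln (real k) * (2 / real k ^ 2) \<le> 2 * real k powr (1/2) * (2 / real k ^ 2)"
      by (intro mult_right_mono) auto
    also have "\<dots> = 4 * real k powr -(3/2)"
    proof -
      have "real k powr (1/2) / real k ^ 2 = real k powr (1/2 - 2)"
        using elim by (subst powr_diff) simp
      then show ?thesis by simp
    qed
    finally show ?case using elim by simp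
  qed
  show "summable (\<lambda>k. 4 * real k powr -(3/2))"
    by (intro summable_mult) (simp add: summable_real_powr_iff)
qed

text \<open>Mertens' first theorem, stated with the weight required by the Tauberian theorem. The
  sums with \<open>1 / p\<close> and \<open>1 / (p - 1)\<close> enclose it and differ by at most
  \<open>D\<close>, so an upper bound for the smaller and a lower bound for the larger one
  suffice.\<close>

lemma mertens_first:
  "\<exists>C. \<forall>n\<ge>1. \<bar>(\<Sum>p | prime p \<and> p \<le> n. - ln (1 - 1 / real p) * ln (real p)) - ln (real n)\<bar> \<le> C"
proof -
  define h where "h k = ln (real k) * (2 / real k ^ 2)" for k :: nat
  have sh: "summable h" unfolding h_def by (rule summable_ln_over_square)
  have h0: "h k \<ge> 0" for k by (cases k) (auto simp: h_def)
  define D where "D = suminf h"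
  have hb: "(\<Sum>p | prime p \<and> p \<le> n. h p) \<le> D" for n
    unfolding D_def using sh h0 finite_primes_le by (intro sum_le_suminf) auto
  have D0: "D \<ge> 0" unfolding D_def using sh h0 by (rule suminf_nonneg)
  show ?thesis
  proof (intro exI allI impI)
    fix n :: nat assume n: "n \<ge> 1"
    let ?W = "\<Sum>p | prime p \<and> p \<le> n. - ln (1 - 1 / real p) * ln (real p)"
    let ?A = "\<Sum>p | prime p \<and> p \<le> n. ln (real p) / real p"
    let ?B = "\<Sum>p | prime p \<and> p \<le> n. ln (real p) / (real p - 1)"
    have AW: "?A \<le> ?W"
    proof (rule sum_mono)
      fix p assume "p \<in> {p. prime p \<and> p \<le> n}"
      then have p: "real p \<ge> 2" by (auto dest: prime_ge_2_nat)
      have "1 / real p * ln (real p) \<le> - ln (1 - 1 / real p) * ln (real p)"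
        using p prime_weight_bounds[of "real p"] by (intro mult_right_mono) auto
      then show "ln (real p) / real p \<le> - ln (1 - 1 / real p) * ln (real p)" by simp
    qed
    have WB: "?W \<le> ?B"
    proof (rule sum_mono)
      fix p assume "p \<in> {p. prime p \<and> p \<le> n}"
      then have p: "real p \<ge> 2" by (auto dest: prime_ge_2_nat)
      have "- ln (1 - 1 / real p) * ln (real p) \<le> 1 / (real p - 1) * ln (real p)"
        using p prime_weight_bounds[of "real p"] by (intro mult_right_mono) auto
      then show "- ln (1 - 1 / real p) * ln (real p) \<le> ln (real p) / (real p - 1)" by simp
    qed
    have "?B \<le> ?A + (\<Sum>p | prime p \<and> p \<le> n. h p)"
      unfolding sum.distrib[symmetric]
    proof (rule sum_mono)
      fix p assume "p \<in> {p. prime p \<and> p \<le> n}"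
      then have p: "real p \<ge> 2" by (auto dest: prime_ge_2_nat)
      then have "1 / (real p - 1) \<le> 1 / real p + 2 / real p ^ 2"
        by (simp add: field_simps power2_eq_square)
      then have "ln (real p) * (1 / (real p - 1)) \<le> ln (real p) * (1 / real p + 2 / real p ^ 2)"
        using p by (intro mult_left_mono) auto
      then show "ln (real p) / (real p - 1) \<le> ln (real p) / real p + h p"
        by (simp add: h_def algebra_simps)
    qed
    with AW WB hb[of n] sum_ln_prime_over_le[OF n] sum_ln_prime_over_ge[OF n] D0 ln_ge_zero[of 4]
    show "\<bar>?W - ln (real n)\<bar> \<le> D + 1 + ln 4" by linarith
  qed
qed

section \<open>The Euler product and the pole of the zeta function\<close>

lemma summable_on_nat_powr:
  assumes "s > 1"
  shows "(\<lambda>n::nat. real n powr -s) summable_on A"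
proof -
  have "(\<lambda>n::nat. real n powr -s) summable_on UNIV"
    using assms by (subst summable_on_UNIV_nonneg_real_iff) (auto simp: summable_real_powr_iff)
  then show ?thesis by (rule summable_on_subset_banach) simp
qed

lemma real_zeta_sums:
  assumes "s > 1"
  shows "(\<lambda>n. real n powr -s) sums real_zeta s"
proof -
  have "summable (\<lambda>n. real n powr -s)" using assms by (simp add: summable_real_powr_iff)
  \<comment> \<open>The defining series starts at 1; starting at 0 adds nothing, as
    \<open>0 powr -s = 0\<close>.\<close>
  then have "(\<lambda>n. real (Suc n) powr -s) sums ((\<Sum>n. real n powr -s) - real 0 powr -s)"
    by (subst sums_Suc_iff) (simp add: summable_sums)
  then have "(\<Sum>n. real n powr -s) = real_zeta s"
    by (simp add: real_zeta_def powr_minus_divide sums_iff)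
  with \<open>summable _\<close> show ?thesis by (simp add: sums_iff)
qed

lemma real_zeta_ge_1:
  assumes "s > 1"
  shows "real_zeta s \<ge> 1"
proof -
  have "(\<Sum>n\<in>{1}. real n powr -s) \<le> (\<Sum>n. real n powr -s)"
    using real_zeta_sums[OF assms] by (intro sum_le_suminf) (auto simp: sums_iff)
  then show ?thesis using real_zeta_sums[OF assms] by (simp add: sums_iff)
qed

lemma infsum_nat_powr:
  assumes "s > 1"
  shows "(\<Sum>\<^sub>\<infinity>n\<in>{0<..}. real n powr -s) = real_zeta s"
proof -
  have "(\<Sum>\<^sub>\<infinity>n\<in>{0<..}. real n powr -s) = (\<Sum>\<^sub>\<infinity>n. real n powr -s)"
    by (rule infsum_cong_neutral) auto
  also have "((\<lambda>n. real n powr -s) has_sum real_zeta s) UNIV"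
    using real_zeta_sums[OF assms] by (intro norm_summable_imp_has_sum) (auto simp: sums_iff)
  then have "(\<Sum>\<^sub>\<infinity>n. real n powr -s) = real_zeta s" by (rule infsumI)
  finally show ?thesis .
qed

text \<open>Finite form of Euler's product, by sieving out one prime at a time. Unordered sums allow
  the multiples of a prime to be split off and rescaled freely.\<close>

lemma infsum_sieved_zeta:
  assumes "s > 1" "finite P" "\<And>p. p \<in> P \<Longrightarrow> prime p"
  shows "(\<Sum>\<^sub>\<infinity>n | n > 0 \<and> (\<forall>p\<in>P. \<not> p dvd n). real n powr -s) = real_zeta s * (\<Prod>p\<in>P. 1 - real p powr -s)"
  using assms(2,3)
proof (induction P rule: finite_induct)
  case empty
  then show ?case using infsum_nat_powr[OF assms(1)] by (simp add: greaterThan_def)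
next
  case (insert p P)
  define A where "A = {n::nat. n > 0 \<and> (\<forall>q\<in>P. \<not> q dvd n)}"
  define A' where "A' = {n::nat. n > 0 \<and> (\<forall>q\<in>insert p P. \<not> q dvd n)}"
  have p: "prime p" "p > 0" using insert by (auto simp: prime_gt_0_nat)
  have ndvd: "\<not> q dvd p" if "q \<in> P" for q
    using that insert primes_dvd_imp_eq by blast
  \<comment> \<open>The multiples of \<open>p\<close> in \<open>A\<close> are \<open>p\<close> times \<open>A\<close>, so removing them multiplies the sum by \<open>1 - p powr -s\<close>.\<close>
  have A: "A = A' \<union> (*) p ` A"
  proof (intro equalityI subsetI)
    fix n assume n: "n \<in> A"
    show "n \<in> A' \<union> (*) p ` A"
    proof (cases "p dvd n")
      case True
      then obtain m where "n = p * m" by blast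
      with n have "m \<in> A" by (auto simp: A_def)
      with \<open>n = p * m\<close> show ?thesis by blast
    qed (use n in \<open>auto simp: A_def A'_def\<close>)
  next
    fix n assume "n \<in> A' \<union> (*) p ` A"
    then show "n \<in> A"
      using p ndvd insert.prems by (auto simp: A_def A'_def prime_dvd_mult_iff)
  qed
  have disj: "A' \<inter> (*) p ` A = {}" by (auto simp: A'_def)
  let ?f = "\<lambda>n::nat. real n powr -s"
  have "infsum ?f A = infsum ?f A' + infsum ?f ((*) p ` A)"
    by (subst A, rule infsum_Un_disjoint) (use disj assms(1) in \<open>auto intro: summable_on_nat_powr\<close>)
  also have "infsum ?f ((*) p ` A) = infsum (\<lambda>n. real p powr -s * ?f n) A"
    using p by (subst infsum_reindex) (auto intro!: inj_onI simp: o_def powr_mult)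
  also have "\<dots> = real p powr -s * infsum ?f A"
    by (intro infsum_cmult_right summable_on_nat_powr assms)
  finally have "infsum ?f A' = (1 - real p powr -s) * infsum ?f A"
    by (simp add: algebra_simps)
  moreover have "infsum ?f A = real_zeta s * (\<Prod>p\<in>P. 1 - real p powr -s)"
    unfolding A_def using insert by blast
  ultimately show ?case using insert.hyps unfolding A'_def by (simp add: mult_ac)
qed

text \<open>After sieving by all primes up to \<open>N\<close>, the number 1 survives and every
  other survivor exceeds \<open>N\<close>. The sieved sum thus lies between 1 and 1 plus a tail of
  the zeta series.\<close>

lemma euler_product_zeta:
  assumes s: "s > 1"
  shows "(\<lambda>N. \<Prod>p | prime p \<and> p \<le> N. 1 - real p powr -s) \<longlonglongrightarrow> 1 / real_zeta s"
proof -
  let ?f = "\<lambda>n::nat. real n powr -s"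
  define A where "A N = {n::nat. n > 0 \<and> (\<forall>p\<in>{p. prime p \<and> p \<le> N}. \<not> p dvd n)}" for N
  have A: "infsum ?f (A N) = real_zeta s * (\<Prod>p | prime p \<and> p \<le> N. 1 - ?f p)" for N
    unfolding A_def by (rule infsum_sieved_zeta) (use s finite_primes_le in auto)
  have lower: "1 \<le> infsum ?f (A N)" for N
  proof -
    have "infsum ?f {1} \<le> infsum ?f (A N)"
      by (rule infsum_mono_neutral) (use s in \<open>auto simp: A_def summable_on_nat_powr\<close>)
    then show ?thesis by simp
  qed
  have upper: "infsum ?f (A N) \<le> 1 + (real_zeta s - (\<Sum>n\<le>N. ?f n))" for N
  proof -
    have sub: "A N \<subseteq> {1} \<union> {N<..}"
    proof
      fix n assume n: "n \<in> A N"
      show "n \<in> {1} \<union> {N<..}"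
      proof (rule ccontr)
        assume "n \<notin> {1} \<union> {N<..}"
        then have "n \<noteq> 1" "n \<le> N" by auto
        then obtain p where p: "prime p" "p dvd n" using prime_factor_nat by blast
        with n \<open>n \<le> N\<close> have "p \<le> N" by (auto simp: A_def dest: dvd_imp_le)
        with p n show False by (auto simp: A_def)
      qed
    qed
    have "infsum ?f (A N) \<le> infsum ?f ({1} \<union> {N<..})"
      by (rule infsum_mono_neutral) (use sub s in \<open>auto simp: summable_on_nat_powr\<close>)
    also have "\<dots> \<le> infsum ?f {1} + infsum ?f {N<..}"
    \<comment> \<open>For \<open>N = 0\<close> the number 1 lies in both sets, so that only an
      inequality holds.\<close>
    proof (cases "N = 0")
      case True
      then have "{1} \<union> {N<..} = {N<..}" by auto
      then show ?thesis by simp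
    next
      case False
      then show ?thesis
        by (subst infsum_Un_disjoint) (use s in \<open>auto intro: summable_on_nat_powr\<close>)
    qed
    also have "infsum ?f {N<..} = real_zeta s - (\<Sum>n\<le>N. ?f n)"
    proof -
      have "UNIV = {..N} \<union> {N<..}" by auto
      then have "infsum ?f UNIV = infsum ?f ({..N} \<union> {N<..})" by simp
      also have "\<dots> = infsum ?f {..N} + infsum ?f {N<..}"
        by (rule infsum_Un_disjoint) (use s in \<open>auto intro: summable_on_nat_powr\<close>)
      also have "infsum ?f UNIV = infsum ?f {0<..}"
        by (rule infsum_cong_neutral) auto
      finally show ?thesis using infsum_nat_powr[OF s] by simp
    qed
    finally show ?thesis by simp
  qed
  have "(\<lambda>N. \<Sum>n\<le>N. ?f n) \<longlonglongrightarrow> real_zeta s"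
    using real_zeta_sums[OF s] by (simp add: sums_def_le)
  then have "(\<lambda>N. 1 + (real_zeta s - (\<Sum>n\<le>N. ?f n))) \<longlonglongrightarrow> 1 + (real_zeta s - real_zeta s)"
    by (intro tendsto_intros)
  then have "(\<lambda>N. infsum ?f (A N)) \<longlonglongrightarrow> 1"
    using tendsto_sandwich[OF always_eventually always_eventually tendsto_const[of 1], of "\<lambda>N. infsum ?f (A N)"
        "\<lambda>N. 1 + (real_zeta s - (\<Sum>n\<le>N. ?f n))" sequentially] lower upper by simp
  then have "(\<lambda>N. infsum ?f (A N) / real_zeta s) \<longlonglongrightarrow> 1 / real_zeta s"
    using real_zeta_ge_1[OF s] by (intro tendsto_intros) auto
  then show ?thesis using real_zeta_ge_1[OF s] by (simp add: A)
qed

section \<open>The logarithm of zeta and its behaviour at 1\<close>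

lemma prime_powr_less_1:
  assumes "prime p" "s > 0"
  shows "real p powr -s < 1"
  using assms prime_gt_1_nat[of p] by (intro powr_less_one) auto

lemma sum_primes_eq: "(\<Sum>p | prime p \<and> p \<le> (N::nat). f p) = (\<Sum>n\<le>N. if prime n then f n else (0::real))"
  by (rule sum.mono_neutral_cong_left) auto

text \<open>The logarithm of the Euler product, indexed by all naturals so that it can be compared
  term by term with the series over primes in Mertens' theorem.\<close>

lemma ln_real_zeta_sums:
  assumes s: "s > 1"
  shows "(\<lambda>n. if prime n then - ln (1 - real n powr -s) else 0) sums ln (real_zeta s)"
proof -
  have "(\<lambda>N. - ln (\<Prod>p | prime p \<and> p \<le> N. 1 - real p powr -s)) \<longlonglongrightarrow> - ln (1 / real_zeta s)"
    using real_zeta_ge_1[OF s] by (intro tendsto_intros euler_product_zeta s) auto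
  moreover have "- ln (\<Prod>p | prime p \<and> p \<le> N. 1 - real p powr -s) =
      (\<Sum>n\<le>N. if prime n then - ln (1 - real n powr -s) else 0)" for N
  proof -
    have "1 - real p powr -s \<noteq> 0" if "p \<in> {p. prime p \<and> p \<le> N}" for p
      using prime_powr_less_1[of p s] that s by auto
    from ln_prod[OF finite_primes_le this] show ?thesis
      unfolding sum_primes_eq[symmetric] sum_negf by simp
  qed
  ultimately show ?thesis using real_zeta_ge_1[OF s] by (simp add: sums_def_le ln_div)
qed

text \<open>The differences of consecutive \<open>n powr -\<epsilon>\<close> telescope to 1. By the
  mean value theorem each lies between two neighbouring terms of the series for
  \<open>\<epsilon> * \<zeta>(1 + \<epsilon>)\<close>, which is therefore between 1 and
  \<open>1 + \<epsilon>\<close>.\<close>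

lemma real_zeta_pole: "((\<lambda>\<epsilon>. \<epsilon> * real_zeta (1 + \<epsilon>)) \<longlongrightarrow> 1) (at_right 0)"
proof -
  have bounds: "1 \<le> \<epsilon> * real_zeta (1 + \<epsilon>) \<and> \<epsilon> * real_zeta (1 + \<epsilon>) \<le> 1 + \<epsilon>" if \<epsilon>: "\<epsilon> > 0" for \<epsilon> :: real
  proof -
    let ?f = "\<lambda>n. real (Suc n) powr -(1 + \<epsilon>)"
    let ?d = "\<lambda>n. real (Suc n) powr -\<epsilon> - real (Suc (Suc n)) powr -\<epsilon>"
    have d: "\<epsilon> * ?f (Suc n) \<le> ?d n" "?d n \<le> \<epsilon> * ?f n" for n
    proof -
      have "\<exists>z. real (Suc n) < z \<and> z < real (Suc (Suc n)) \<and>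
          real (Suc (Suc n)) powr -\<epsilon> - real (Suc n) powr -\<epsilon> =
          (real (Suc (Suc n)) - real (Suc n)) * (-\<epsilon> * z powr (-\<epsilon> - 1))"
        by (rule MVT2) (auto intro!: derivative_eq_intros simp: powr_diff)
      then obtain z where z: "real (Suc n) < z" "z < real (Suc (Suc n))"
          "real (Suc (Suc n)) powr -\<epsilon> - real (Suc n) powr -\<epsilon> =
            (real (Suc (Suc n)) - real (Suc n)) * (-\<epsilon> * z powr (-\<epsilon> - 1))" by blast
      have "-\<epsilon> - 1 = -(1 + \<epsilon>)" by simp
      with z(3) have z3: "?d n = \<epsilon> * z powr -(1 + \<epsilon>)" by simp
      have "?f (Suc n) \<le> z powr -(1 + \<epsilon>)" "z powr -(1 + \<epsilon>) \<le> ?f n"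
        using z \<epsilon> by (intro powr_mono2'; simp)+
      then show "\<epsilon> * ?f (Suc n) \<le> ?d n" "?d n \<le> \<epsilon> * ?f n"
        unfolding z3 using \<epsilon> by (auto intro: mult_left_mono)
    qed
    have "(\<lambda>n. real (Suc n) powr -\<epsilon>) \<longlonglongrightarrow> 0"
      using \<epsilon> by (intro LIMSEQ_Suc tendsto_neg_powr filterlim_real_sequentially) auto
    from telescope_sums'[OF this] have ds: "?d sums 1" by simp
    have "(\<lambda>n. real n powr -(1 + \<epsilon>)) sums real_zeta (1 + \<epsilon>)"
      using \<epsilon> by (intro real_zeta_sums) auto
    then have fs: "?f sums real_zeta (1 + \<epsilon>)" by (subst sums_Suc_iff) simp
    then have fs': "(\<lambda>n. ?f (Suc n)) sums (real_zeta (1 + \<epsilon>) - 1)"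
      by (subst sums_Suc_iff) simp
    have "1 \<le> \<epsilon> * real_zeta (1 + \<epsilon>)"
      by (rule sums_le[OF _ ds sums_mult[OF fs]]) (use d in auto)
    moreover have "\<epsilon> * (real_zeta (1 + \<epsilon>) - 1) \<le> 1"
      by (rule sums_le[OF _ sums_mult[OF fs'] ds]) (use d in auto)
    ultimately show ?thesis by (simp add: algebra_simps)
  qed
  have ep: "\<forall>\<^sub>F \<epsilon> in at_right (0::real). \<epsilon> > 0" by (simp add: eventually_at_right_less)
  have "((\<lambda>\<epsilon>::real. 1 + \<epsilon>) \<longlongrightarrow> 1 + 0) (at_right 0)" by (intro tendsto_intros)
  then have lim: "((\<lambda>\<epsilon>::real. 1 + \<epsilon>) \<longlongrightarrow> 1) (at_right 0)" by simp
  show ?thesis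
    by (rule tendsto_sandwich[OF _ _ tendsto_const lim])
       (use bounds in \<open>auto intro: eventually_mono[OF ep]\<close>)
qed

section \<open>Mertens' third theorem\<close>

text \<open>To be used with \<open>y = 1 / p\<close> and \<open>a = p powr -\<epsilon>\<close>. The
  expression vanishes at \<open>a = 1\<close>, and its derivative in \<open>a\<close> is a
  difference of two numbers from \<open>[y, y / (1 - y)]\<close>, an interval of length at most
  \<open>2 * y\<^sup>2\<close>.\<close>

lemma prime_log_perturbation:
  fixes y a :: real
  assumes y: "0 < y" "y \<le> 1/2" and a: "0 \<le> a" "a \<le> 1"
  shows "\<bar>- a * ln (1 - y) + ln (1 - a * y)\<bar> \<le> 2 * y\<^sup>2 * (1 - a)"
proof (cases "a = 1")
  case False
  then have a1: "a < 1" using a by simp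
  define \<phi> where "\<phi> b = - b * ln (1 - y) + ln (1 - b * y)" for b
  have by_le: "b * y \<le> y" if "b \<le> 1" for b using mult_right_mono[of b 1 y] that y by simp
  have "\<exists>z. a < z \<and> z < 1 \<and> \<phi> 1 - \<phi> a = (1 - a) * (- ln (1 - y) - y / (1 - z * y))"
  proof (rule MVT2[OF a1])
    fix b assume "a \<le> b" "b \<le> 1"
    then have "1 - b * y > 0" using by_le[OF \<open>b \<le> 1\<close>] y by linarith
    then show "(\<phi> has_real_derivative - ln (1 - y) - y / (1 - b * y)) (at b)"
      unfolding \<phi>_def by (auto intro!: derivative_eq_intros)
  qed
  then obtain z where z: "a < z" "z < 1" "\<phi> 1 - \<phi> a = (1 - a) * (- ln (1 - y) - y / (1 - z * y))"
    by blast
  have zy: "0 \<le> z * y" "z * y \<le> y" using z a y by_le[of z] by auto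
  have zy1: "1 - z * y > 0" "1 - y > 0" using zy y by linarith+
  have w: "y \<le> - ln (1 - y)" "- ln (1 - y) \<le> y / (1 - y)"
    using prime_weight_bounds[of "1 / y"] y by (simp_all add: field_simps)
  have q: "y \<le> y / (1 - z * y)" "y / (1 - z * y) \<le> y / (1 - y)"
  proof -
    have "y / 1 \<le> y / (1 - z * y)" using y zy zy1 by (intro divide_left_mono mult_pos_pos) auto
    then show "y \<le> y / (1 - z * y)" by simp
    show "y / (1 - z * y) \<le> y / (1 - y)" using y zy zy1 by (intro divide_left_mono mult_pos_pos) auto
  qed
  have "y / (1 - y) - y = y\<^sup>2 / (1 - y)" using y by (simp add: field_simps power2_eq_square)
  also have "\<dots> \<le> y\<^sup>2 / (1 / 2)" using y by (intro divide_left_mono) auto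
  also have "\<dots> = 2 * y\<^sup>2" by simp
  finally have "\<bar>- ln (1 - y) - y / (1 - z * y)\<bar> \<le> 2 * y\<^sup>2" using w q by linarith
  then have "(1 - a) * \<bar>- ln (1 - y) - y / (1 - z * y)\<bar> \<le> (1 - a) * (2 * y\<^sup>2)"
    using a by (intro mult_left_mono) auto
  moreover have "\<bar>\<phi> a\<bar> = (1 - a) * \<bar>- ln (1 - y) - y / (1 - z * y)\<bar>"
  proof -
    have "\<phi> 1 = 0" by (simp add: \<phi>_def)
    then have "\<phi> a = - ((1 - a) * (- ln (1 - y) - y / (1 - z * y)))" using z(3) by simp
    then show ?thesis using a by (simp only: abs_minus_cancel abs_mult)
  qed
  ultimately show ?thesis by (simp add: \<phi>_def mult_ac)
qed simp

lemma one_minus_powr_neg_le: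
  fixes x \<epsilon> :: real
  assumes "x > 0"
  shows "1 - x powr -\<epsilon> \<le> \<epsilon> * ln x"
  using assms exp_ge_add_one_self[of "- \<epsilon> * ln x"] by (simp add: powr_def)

text \<open>Each term differs from that of \<open>ln (\<zeta>(1 + \<epsilon>))\<close> by at most
  \<open>2 / p\<^sup>2\<close> times \<open>1 - p powr -\<epsilon>\<close>, and the latter is at
  most \<open>\<epsilon> * ln p\<close>. Convergence is inherited from the zeta side.\<close>

lemma prime_weight_series:
  fixes \<epsilon> :: real
  assumes \<epsilon>: "\<epsilon> > 0"
  defines "f \<equiv> \<lambda>n. (if prime n then - ln (1 - 1 / real n) else 0) * real n powr -\<epsilon>"
  shows "summable f"
    "\<bar>suminf f - ln (real_zeta (1 + \<epsilon>))\<bar> \<le> \<epsilon> * (\<Sum>k. ln (real k) * (2 / real k ^ 2))"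
proof -
  let ?h = "\<lambda>k::nat. ln (real k) * (2 / real k ^ 2)"
  let ?v = "\<lambda>n. if prime n then - ln (1 - real n powr -(1 + \<epsilon>)) else 0"
  have v: "?v sums ln (real_zeta (1 + \<epsilon>))" using \<epsilon> by (intro ln_real_zeta_sums) auto
  have h: "summable (\<lambda>k. \<epsilon> * ?h k)" by (intro summable_mult summable_ln_over_square)
  have bound: "\<bar>f n - ?v n\<bar> \<le> \<epsilon> * ?h n" for n
  proof (cases "prime n")
    case True
    then have n: "real n \<ge> 2" by (auto dest: prime_ge_2_nat)
    have pw: "real n powr -(1 + \<epsilon>) = real n powr -\<epsilon> * (1 / real n)"
      using n by (simp add: powr_diff powr_minus_divide powr_add field_simps)
    have le1: "real n powr -\<epsilon> \<le> 1" using n \<epsilon> powr_mono[of "-\<epsilon>" 0 "real n"] by simp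
    have "\<bar>f n - ?v n\<bar> \<le> 2 * (1 / real n)\<^sup>2 * (1 - real n powr -\<epsilon>)"
      using prime_log_perturbation[of "1 / real n" "real n powr -\<epsilon>"] n le1 True
      unfolding f_def pw by (simp add: field_simps)
    also have "\<dots> \<le> 2 * (1 / real n)\<^sup>2 * (\<epsilon> * ln (real n))"
      using n by (intro mult_left_mono one_minus_powr_neg_le) auto
    also have "\<dots> = \<epsilon> * ?h n" by (simp add: power_divide)
    finally show ?thesis .
  next
    case False
    then show ?thesis using \<epsilon> by (cases n) (auto simp: f_def)
  qed
  have d: "summable (\<lambda>n. \<bar>f n - ?v n\<bar>)"
    by (rule summable_comparison_test'[OF h, of 0]) (use bound in auto)
  then have d': "summable (\<lambda>n. f n - ?v n)" by (rule summable_rabs_cancel)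
  from summable_add[OF d' sums_summable[OF v]] show f: "summable f" by simp
  have "suminf f - ln (real_zeta (1 + \<epsilon>)) = (\<Sum>n. f n - ?v n)"
    using suminf_diff[OF f sums_summable[OF v]] v by (simp add: sums_iff)
  also have "\<bar>\<dots>\<bar> \<le> (\<Sum>n. \<bar>f n - ?v n\<bar>)" by (rule summable_rabs[OF d])
  also have "\<dots> \<le> (\<Sum>n. \<epsilon> * ?h n)" by (intro suminf_le bound d h)
  also have "\<dots> = \<epsilon> * (\<Sum>n. ?h n)" by (intro suminf_mult summable_ln_over_square)
  finally show "\<bar>suminf f - ln (real_zeta (1 + \<epsilon>))\<bar> \<le> \<epsilon> * (\<Sum>n. ?h n)" .
qed

text \<open>The Tauberian theorem applies: up to \<open>O(\<epsilon>)\<close> the prime series is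
  \<open>ln (\<zeta>(1 + \<epsilon>))\<close>, which is \<open>- ln \<epsilon> + o(1)\<close>
  because \<open>\<epsilon> * \<zeta>(1 + \<epsilon>)\<close> tends to 1.\<close>

theorem mertens_third_log:
  "((\<lambda>x. (\<Sum>p | prime p \<and> p \<le> nat \<lfloor>x\<rfloor>. - ln (1 - 1 / real p)) - ln (ln x)) \<longlongrightarrow> euler_mascheroni) at_top"
proof -
  define u where "u n = (if prime n then - ln (1 - 1 / real n) else 0)" for n :: nat
  have u0: "u n \<ge> 0" for n
  proof (cases "prime n")
    case True
    then have n: "real n \<ge> 2" by (auto dest: prime_ge_2_nat)
    have "0 \<le> 1 / real n" by simp
    also have "\<dots> \<le> u n" using prime_weight_bounds(1)[OF n] True by (simp add: u_def)
    finally show ?thesis .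
  qed (simp add: u_def)
  obtain C where C: "\<And>n. n \<ge> 1 \<Longrightarrow> \<bar>(\<Sum>p | prime p \<and> p \<le> n. - ln (1 - 1 / real p) * ln (real p)) - ln (real n)\<bar> \<le> C"
    using mertens_first by blast
  define D where "D = (\<Sum>k. ln (real k) * (2 / real k ^ 2))"
  have ep: "\<forall>\<^sub>F \<epsilon> in at_right (0::real). \<epsilon> > 0" by (simp add: eventually_at_right_less)
  have "((\<lambda>\<epsilon>. (\<Sum>n. u n * real n powr -\<epsilon>) - ln (real_zeta (1 + \<epsilon>))) \<longlongrightarrow> 0) (at_right 0)"
  proof (rule Lim_null_comparison)
    show "\<forall>\<^sub>F \<epsilon> in at_right 0. norm ((\<Sum>n. u n * real n powr -\<epsilon>) - ln (real_zeta (1 + \<epsilon>))) \<le> \<epsilon> * D"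
      using ep by eventually_elim (use prime_weight_series(2) in \<open>simp add: u_def D_def\<close>)
    have "((\<lambda>\<epsilon>::real. \<epsilon> * D) \<longlongrightarrow> 0 * D) (at_right 0)" by (intro tendsto_intros)
    then show "((\<lambda>\<epsilon>. \<epsilon> * D) \<longlongrightarrow> 0) (at_right 0)" by simp
  qed
  moreover have "((\<lambda>\<epsilon>. ln (real_zeta (1 + \<epsilon>)) + ln \<epsilon>) \<longlongrightarrow> 0) (at_right 0)"
  proof (rule Lim_transform_eventually)
    show "((\<lambda>\<epsilon>. ln (\<epsilon> * real_zeta (1 + \<epsilon>))) \<longlongrightarrow> 0) (at_right 0)"
      using tendsto_ln[OF real_zeta_pole] by simp
    show "\<forall>\<^sub>F \<epsilon> in at_right 0. ln (\<epsilon> * real_zeta (1 + \<epsilon>)) = ln (real_zeta (1 + \<epsilon>)) + ln \<epsilon>"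
      using ep
    proof eventually_elim
      case (elim \<epsilon>)
      then have "real_zeta (1 + \<epsilon>) > 0" using real_zeta_ge_1[of "1 + \<epsilon>"] by simp
      then show ?case using elim by (simp add: ln_mult)
    qed
  qed
  ultimately have lim: "((\<lambda>\<epsilon>. (\<Sum>n. u n * real n powr -\<epsilon>) + ln \<epsilon>) \<longlongrightarrow> 0) (at_right 0)"
    using tendsto_add by fastforce
  have "((\<lambda>x. (\<Sum>n\<le>nat \<lfloor>x\<rfloor>. u n) - ln (ln x)) \<longlongrightarrow> euler_mascheroni) at_top"
  proof (rule mertens_tauberian[OF u0 _ _ _ _ lim])
    show "u 0 = 0" "u 1 = 0" by (simp_all add: u_def)
    show "\<bar>(\<Sum>n\<le>N. u n * ln n) - ln N\<bar> \<le> C" if "N \<ge> 1" for N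
    proof -
      have "(\<Sum>n\<le>N. u n * ln n) = (\<Sum>p | prime p \<and> p \<le> N. - ln (1 - 1 / real p) * ln (real p))"
        unfolding sum_primes_eq u_def by (rule sum.cong) auto
      then show ?thesis using C[OF that] by simp
    qed
    show "summable (\<lambda>n. u n * real n powr -\<epsilon>)" if "\<epsilon> > 0" for \<epsilon>
      unfolding u_def by (rule prime_weight_series(1)[OF that])
  qed
  then show ?thesis unfolding sum_primes_eq u_def .
qed

theorem mertens_third:
  "((\<lambda>x. (\<Prod>p | prime p \<and> p \<le> nat \<lfloor>x\<rfloor>. 1 / (1 - 1 / real p)) / ln x) \<longlongrightarrow> exp euler_mascheroni) at_top"
proof (rule Lim_transform_eventually)
  show "((\<lambda>x. exp ((\<Sum>p | prime p \<and> p \<le> nat \<lfloor>x\<rfloor>. - ln (1 - 1 / real p)) - ln (ln x))) \<longlongrightarrow> exp euler_mascheroni) at_top"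
    by (intro tendsto_exp mertens_third_log)
  show "\<forall>\<^sub>F x in at_top. exp ((\<Sum>p | prime p \<and> p \<le> nat \<lfloor>x\<rfloor>. - ln (1 - 1 / real p)) - ln (ln x)) =
      (\<Prod>p | prime p \<and> p \<le> nat \<lfloor>x\<rfloor>. 1 / (1 - 1 / real p)) / ln x"
    using eventually_gt_at_top[of "1::real"]
  proof eventually_elim
    case (elim x)
    have "exp (\<Sum>p | prime p \<and> p \<le> nat \<lfloor>x\<rfloor>. - ln (1 - 1 / real p)) = (\<Prod>p | prime p \<and> p \<le> nat \<lfloor>x\<rfloor>. 1 / (1 - 1 / real p))"
      unfolding exp_sum[OF finite_primes_le]
    proof (intro prod.cong refl)
      fix p assume "p \<in> {p. prime p \<and> p \<le> nat \<lfloor>x\<rfloor>}"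
      then have "real p > 1" by (auto dest: prime_gt_1_nat)
      then show "exp (- ln (1 - 1 / real p)) = 1 / (1 - 1 / real p)" by (simp add: exp_minus inverse_eq_divide)
    qed
    then show ?case using elim by (simp add: exp_diff)
  qed
qed

section \<open>Local factors of the divisor function\<close>

text \<open>A divisor of \<open>a * b\<close> is a product \<open>d * e\<close> in exactly one way;
  its gcds with \<open>a\<close> and \<open>b\<close> recover the two parts.\<close>

lemma sum_divisors_mult_coprime:
  fixes a b :: nat and f :: "nat \<Rightarrow> 'a::comm_monoid_add"
  assumes "coprime a b"
  shows "(\<Sum>d | d dvd a * b. f d) = (\<Sum>d | d dvd a. \<Sum>e | e dvd b. f (d * e))"
proof -
  have gcd1: "gcd (d * e) a = d" "gcd (d * e) b = e" if "d dvd a" "e dvd b" for d e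
  proof -
    have "coprime e a" "coprime d b"
      using that assms by (meson coprime_divisors dvd_refl coprime_commute)+
    then show "gcd (d * e) a = d" "gcd (d * e) b = e"
      using that by (simp_all add: gcd_mult_right_right_cancel gcd_mult_right_left_cancel gcd_mult_left_right_cancel gcd_mult_left_left_cancel coprime_commute)
  qed
  have "bij_betw (\<lambda>(d, e). d * e) ({d. d dvd a} \<times> {e. e dvd b}) {d. d dvd a * b}"
  proof (rule bij_betwI[where g = "\<lambda>d. (gcd d a, gcd d b)"])
    fix d assume "d \<in> {d. d dvd a * b}"
    then obtain d1 d2 where "d = d1 * d2" "d1 dvd a" "d2 dvd b" using division_decomp by blast
    then show "(case (gcd d a, gcd d b) of (d, e) \<Rightarrow> d * e) = d" using gcd1 by simp
  qed (use gcd1 in \<open>auto intro: mult_dvd_mono\<close>)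
  from sum.reindex_bij_betw[OF this, of f] show ?thesis
    by (simp add: sum.cartesian_product case_prod_unfold)
qed

lemma moebius_mult_coprime:
  assumes "coprime a b" "a > 0" "b > 0"
  shows "moebius (a * b) = moebius a * moebius b"
proof (cases "squarefree a \<and> squarefree b")
  case True
  have "prime_factors a \<inter> prime_factors b = {}"
    using assms(1) by (auto simp: in_prime_factors_iff dest: coprime_common_divisor_nat)
  then have "card (prime_factors (a * b)) = card (prime_factors a) + card (prime_factors b)"
    using assms by (simp add: prime_factors_product card_Un_disjoint)
  then show ?thesis using True squarefree_mult_coprime[OF assms(1)] by (simp add: moebius_def power_add)
next
  case False
  then show ?thesis using squarefree_multD[of a b] by (auto simp: moebius_def)
qed

lemma divisor_sum_mult_coprime:
  assumes "coprime a b"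
  shows "divisor_sum (a * b) = divisor_sum a * divisor_sum b"
  unfolding divisor_sum_def sum_divisors_mult_coprime[OF assms] sum_product ..

text \<open>A Dirichlet convolution of multiplicative functions: every summand splits along the
  factorisation \<open>d * e\<close> of the divisor.\<close>

lemma divisor_sum_lcm_mult_coprime:
  assumes "coprime a b" "a > 0" "b > 0"
  shows "divisor_sum_lcm \<kappa> (a * b) = divisor_sum_lcm \<kappa> a * divisor_sum_lcm \<kappa> b"
proof -
  have "of_int (moebius (a * b div (d * e))) * real (divisor_sum (d * e)) powr \<kappa> =
    (of_int (moebius (a div d)) * real (divisor_sum d) powr \<kappa>) * (of_int (moebius (b div e)) * real (divisor_sum e) powr \<kappa>)"
    if d: "d dvd a" and e: "e dvd b" for d e
  proof -
    have "a * b div (d * e) = (a div d) * (b div e)" by (rule div_mult_div_if_dvd[OF d e, symmetric])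
    moreover have "coprime (a div d) (b div e)"
      using assms(1) coprime_divisors[of "a div d" a "b div e" b] d e
      by (metis dvd_div_mult_self dvd_triv_left)
    moreover have "coprime d e" using coprime_divisors[OF d e assms(1)] .
    moreover have "a div d > 0" "b div e > 0" using assms d e by (auto simp: div_greater_zero_iff dvd_imp_le dvd_pos_nat)
    ultimately show ?thesis
      by (simp add: moebius_mult_coprime divisor_sum_mult_coprime powr_mult)
  qed
  then show ?thesis
    unfolding divisor_sum_lcm_def sum_divisors_mult_coprime[OF assms(1)] sum_product
    by (intro sum.cong refl) auto
qed

lemma multiplicative_prod_prime_powers:
  fixes f :: "nat \<Rightarrow> real"
  assumes one: "f 1 = 1"
    and mult: "\<And>a b. coprime a b \<Longrightarrow> a > 0 \<Longrightarrow> b > 0 \<Longrightarrow> f (a * b) = f a * f b"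
    and A: "finite A" "\<And>p. p \<in> A \<Longrightarrow> prime p"
  shows "f (\<Prod>p\<in>A. p ^ e p) = (\<Prod>p\<in>A. f (p ^ e p))"
  using A
proof (induction A rule: finite_induct)
  case (insert p A)
  have "coprime (p ^ e p) (\<Prod>q\<in>A. q ^ e q)"
    by (rule prod_coprime_right) (use insert in \<open>auto intro!: primes_coprime\<close>)
  moreover have "p ^ e p > 0" "(\<Prod>q\<in>A. q ^ e q) > 0"
    using insert.prems by (auto intro!: prod_pos simp: prime_gt_0_nat)
  ultimately show ?case using insert by (simp add: mult)
qed (use one in simp)

section \<open>Values at prime powers\<close>

lemma sum_divisors_prime_power:
  fixes p :: nat
  assumes "prime p"
  shows "(\<Sum>d | d dvd p ^ a. f d) = (\<Sum>i\<le>a. f (p ^ i))"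
proof -
  have "{d. d dvd p ^ a} = (\<lambda>i. p ^ i) ` {..a}"
    using divides_primepow_nat[OF assms] by auto
  moreover have "inj_on (\<lambda>i. p ^ i) {..a}"
    using assms prime_gt_1_nat[OF assms] by (auto intro!: inj_onI)
  ultimately show ?thesis by (simp add: sum.reindex)
qed

lemma divisor_sum_prime_power:
  assumes p: "prime p"
  shows "real (divisor_sum (p ^ a)) = (real p ^ Suc a - 1) / (real p - 1)"
proof -
  have "real p > 1" using prime_gt_1_nat[OF p] by simp
  then show ?thesis unfolding divisor_sum_def sum_divisors_prime_power[OF p] of_nat_sum of_nat_power
    by (subst sum_gp0) (simp add: field_simps)
qed

text \<open>The Moebius factor at \<open>p ^ (b + 1 - i)\<close> vanishes unless the exponent is 0
  or 1, where it is 1 and -1.\<close>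

lemma divisor_sum_lcm_prime_power:
  assumes p: "prime p"
  shows "divisor_sum_lcm \<kappa> (p ^ Suc b) =
    real (divisor_sum (p ^ Suc b)) powr \<kappa> - real (divisor_sum (p ^ b)) powr \<kappa>"
proof -
  have p1: "p > 1" using prime_gt_1_nat[OF p] .
  let ?g = "\<lambda>i. of_int (moebius (p ^ Suc b div p ^ i)) * real (divisor_sum (p ^ i)) powr \<kappa>"
  have quot: "p ^ Suc b div p ^ i = p ^ (Suc b - i)" if "i \<le> Suc b" for i
    using p1 that by (simp add: power_diff)
  have "(\<Sum>i\<le>Suc b. ?g i) = (\<Sum>i\<in>{b, Suc b}. ?g i)"
  proof (rule sum.mono_neutral_right)
    show "\<forall>i\<in>{..Suc b} - {b, Suc b}. ?g i = 0"
    proof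
      fix i assume i: "i \<in> {..Suc b} - {b, Suc b}"
      then have "\<not> squarefree (p ^ (Suc b - i))" using p1 by (auto simp: squarefree_power_iff)
      then show "?g i = 0" using quot[of i] i by (simp add: moebius_def)
    qed
  qed auto
  moreover have "moebius p = -1"
    using p by (simp add: moebius_def squarefree_prime prime_factorization_prime)
  moreover have "moebius 1 = 1" by (simp add: moebius_def)
  moreover have "p ^ Suc b div p ^ b = p" "p ^ Suc b div p ^ Suc b = 1"
    using quot[of b] quot[of "Suc b"] by simp_all
  ultimately show ?thesis
    unfolding divisor_sum_lcm_def sum_divisors_prime_power[OF p] by simp
qed

text \<open>For prime \<open>p\<close> and \<open>a > 0\<close> this is the value at
  \<open>p ^ a\<close> divided by \<open>(p ^ a) powr \<kappa>\<close>. With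
  \<open>q = 1 / p\<close>, the divisor sums of \<open>p ^ a\<close> and \<open>p ^ (a - 1)\<close>
  are \<open>p ^ a / (1 - q)\<close> times \<open>1 - q ^ (a + 1)\<close> and
  \<open>q - q ^ (a + 1)\<close>.\<close>

definition prime_power_factor :: "real \<Rightarrow> nat \<Rightarrow> nat \<Rightarrow> real" where
  "prime_power_factor \<kappa> p a =
    ((1 - (1 / real p) ^ Suc a) powr \<kappa> - (1 / real p - (1 / real p) ^ Suc a) powr \<kappa>) / (1 - 1 / real p) powr \<kappa>"

lemma divisor_sum_lcm_prime_power_eq:
  assumes p: "prime p" and a: "a > 0"
  shows "divisor_sum_lcm \<kappa> (p ^ a) = real (p ^ a) powr \<kappa> * prime_power_factor \<kappa> p a"
proof -
  obtain b where b: "a = Suc b" using a by (cases a) auto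
  have p1: "real p > 1" using prime_gt_1_nat[OF p] by simp
  define q where "q = 1 / real p"
  have q: "0 < q" "q < 1" "real p = 1 / q" using p1 by (auto simp: q_def)
  have "q ^ Suc a \<le> q ^ 1" using q by (intro power_decreasing) auto
  then have t: "q ^ Suc a \<le> q" by simp
  have 1: "real (divisor_sum (p ^ a)) = real (p ^ a) * ((1 - q ^ Suc a) / (1 - q))"
    unfolding divisor_sum_prime_power[OF p] q_def using p1
    by (simp add: power_one_over divide_simps)
  have 2: "real (divisor_sum (p ^ b)) = real (p ^ a) * ((q - q ^ Suc a) / (1 - q))"
    unfolding divisor_sum_prime_power[OF p] b q_def using p1
    by (simp add: power_one_over divide_simps)
  have "real (divisor_sum (p ^ a)) powr \<kappa> = real (p ^ a) powr \<kappa> * ((1 - q ^ Suc a) powr \<kappa> / (1 - q) powr \<kappa>)"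
    unfolding 1 by (simp only: powr_mult powr_divide)
  moreover have "real (divisor_sum (p ^ b)) powr \<kappa> = real (p ^ a) powr \<kappa> * ((q - q ^ Suc a) powr \<kappa> / (1 - q) powr \<kappa>)"
    unfolding 2 by (simp only: powr_mult powr_divide)
  ultimately show ?thesis
    using divisor_sum_lcm_prime_power[OF p, of \<kappa> b] unfolding b[symmetric] prime_power_factor_def q_def[symmetric]
    by (simp add: diff_divide_distrib right_diff_distrib)
qed

lemma divisor_sum_lcm_prod_prime_powers:
  assumes "finite A" "\<And>p. p \<in> A \<Longrightarrow> prime p" "\<And>p. p \<in> A \<Longrightarrow> e p > 0"
  shows "divisor_sum_lcm \<kappa> (\<Prod>p\<in>A. p ^ e p) =
    real (\<Prod>p\<in>A. p ^ e p) powr \<kappa> * (\<Prod>p\<in>A. prime_power_factor \<kappa> p (e p))"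
proof -
  have "divisor_sum_lcm \<kappa> 1 = 1" by (simp add: divisor_sum_lcm_def divisor_sum_def moebius_def)
  then have "divisor_sum_lcm \<kappa> (\<Prod>p\<in>A. p ^ e p) = (\<Prod>p\<in>A. divisor_sum_lcm \<kappa> (p ^ e p))"
    using divisor_sum_lcm_mult_coprime assms by (intro multiplicative_prod_prime_powers) auto
  also have "\<dots> = (\<Prod>p\<in>A. real (p ^ e p) powr \<kappa> * prime_power_factor \<kappa> p (e p))"
    using assms by (intro prod.cong refl divisor_sum_lcm_prime_power_eq) auto
  also have "(\<Prod>p\<in>A. real (p ^ e p) powr \<kappa> * prime_power_factor \<kappa> p (e p)) =
      real (\<Prod>p\<in>A. p ^ e p) powr \<kappa> * (\<Prod>p\<in>A. prime_power_factor \<kappa> p (e p))"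
    unfolding of_nat_prod prod.distrib by (subst prod_powr_distrib) auto
  finally show ?thesis .
qed

text \<open>Multiplied over primes, the numerators form the Euler product of
  \<open>1 / \<zeta>(\<kappa>)\<close> and the reciprocals of the denominators form the \<kappa>-th
  power of Mertens' product.\<close>

definition prime_limit_factor :: "real \<Rightarrow> nat \<Rightarrow> real" where
  "prime_limit_factor \<kappa> p = (1 - real p powr -\<kappa>) / (1 - 1 / real p) powr \<kappa>"

section \<open>Comparison of the local factors with their limits\<close>

lemma inverse_prime_powr_le:
  assumes "prime p" "\<kappa> \<ge> 1"
  shows "real p powr -\<kappa> \<le> 1 / real p"
proof -
  have "real p > 1" using prime_gt_1_nat[OF assms(1)] by simp
  then have "real p powr -\<kappa> \<le> real p powr -1" using assms by (intro powr_mono) auto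
  then show ?thesis by (simp add: powr_minus_divide)
qed

text \<open>With \<open>q = 1 / p\<close> one has
  \<open>(1 - q) powr \<kappa> \<le> 1 - q \<le> 1 - q powr \<kappa>\<close>. The lower bound
  permits further primes to be added to a product, the upper one controls large primes.\<close>

lemma prime_limit_factor_bounds:
  assumes "prime p" "\<kappa> \<ge> 1"
  shows "1 \<le> prime_limit_factor \<kappa> p" "prime_limit_factor \<kappa> p \<le> (1 - 1 / real p) powr -\<kappa>"
proof -
  have p: "real p > 1" using prime_gt_1_nat[OF assms(1)] by simp
  then have q: "0 < 1 - 1 / real p" "1 - 1 / real p \<le> 1" by auto
  have "(1 - 1 / real p) powr \<kappa> \<le> (1 - 1 / real p) powr 1"
    using q assms by (intro powr_mono') auto
  also have "\<dots> \<le> 1 - real p powr -\<kappa>" using inverse_prime_powr_le[OF assms] q by simp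
  finally show "1 \<le> prime_limit_factor \<kappa> p" using p q by (simp add: prime_limit_factor_def le_divide_eq)
  show "prime_limit_factor \<kappa> p \<le> (1 - 1 / real p) powr -\<kappa>"
    unfolding prime_limit_factor_def powr_minus_divide[of "1 - 1 / real p"]
    by (rule divide_right_mono) auto
qed

text \<open>The left side decreases in \<open>t\<close>: the power with the larger base falls at
  least as fast, as \<open>\<kappa> - 1 \<ge> 0\<close>. The strict \<open>t < q\<close> keeps both
  bases positive, where \<open>powr\<close> is differentiable.\<close>

lemma powr_diff_shift_le:
  fixes q t \<kappa> :: real
  assumes "0 \<le> t" "t < q" "q \<le> 1" "\<kappa> \<ge> 1"
  shows "(1 - t) powr \<kappa> - (q - t) powr \<kappa> \<le> 1 - q powr \<kappa>"
proof -
  let ?\<phi> = "\<lambda>t. (1 - t) powr \<kappa> - (q - t) powr \<kappa>"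
  have "?\<phi> t \<le> ?\<phi> 0"
  proof (rule DERIV_nonpos_imp_nonincreasing[OF assms(1)])
    fix s assume s: "0 \<le> s" "s \<le> t"
    have "(?\<phi> has_real_derivative \<kappa> * (q - s) powr (\<kappa> - 1) - \<kappa> * (1 - s) powr (\<kappa> - 1)) (at s)"
      using s assms by (auto intro!: derivative_eq_intros simp: powr_diff)
    moreover have "\<kappa> * (q - s) powr (\<kappa> - 1) \<le> \<kappa> * (1 - s) powr (\<kappa> - 1)"
      using s assms by (intro mult_left_mono powr_mono2) auto
    ultimately show "\<exists>y. (?\<phi> has_real_derivative y) (at s) \<and> y \<le> 0" by force
  qed
  then show ?thesis by simp
qed

text \<open>Bernoulli's inequality for a real exponent.\<close>

lemma powr_one_minus_ge:
  fixes t \<kappa> :: real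
  assumes "0 \<le> t" "t < 1" "\<kappa> \<ge> 1"
  shows "1 - \<kappa> * t \<le> (1 - t) powr \<kappa>"
proof -
  let ?\<phi> = "\<lambda>t. (1 - t) powr \<kappa> + \<kappa> * t"
  have "?\<phi> 0 \<le> ?\<phi> t"
  proof (rule DERIV_nonneg_imp_nondecreasing[OF assms(1)])
    fix s assume s: "0 \<le> s" "s \<le> t"
    have "(?\<phi> has_real_derivative \<kappa> - \<kappa> * (1 - s) powr (\<kappa> - 1)) (at s)"
      using s assms by (auto intro!: derivative_eq_intros simp: powr_diff)
    moreover have "(1 - s) powr (\<kappa> - 1) \<le> 1"
      using s assms by (intro powr_le1) auto
    then have "\<kappa> * (1 - s) powr (\<kappa> - 1) \<le> \<kappa>" using assms by (intro mult_left_le) auto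
    ultimately show "\<exists>y. (?\<phi> has_real_derivative y) (at s) \<and> 0 \<le> y" by force
  qed
  then show ?thesis by simp
qed

text \<open>With \<open>t = q ^ (a + 1)\<close>, the upper bound is the monotonicity in
  \<open>t\<close>; the lower one uses Bernoulli for \<open>1 - t\<close> and drops \<open>t\<close>
  from \<open>q - t\<close>. It is a relative error bound, so that it can be multiplied over many
  primes.\<close>

lemma prime_power_factor_bounds:
  assumes p: "prime p" and a: "a > 0" and \<kappa>: "\<kappa> \<ge> 1"
  shows "prime_power_factor \<kappa> p a \<le> prime_limit_factor \<kappa> p"
    "prime_limit_factor \<kappa> p * (1 - 2 * \<kappa> * (1 / real p) ^ Suc a) \<le> prime_power_factor \<kappa> p a"
proof -
  define q where "q = 1 / real p"
  define t where "t = q ^ Suc a"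
  have p2: "real p \<ge> 2" using prime_ge_2_nat[OF p] by simp
  have q: "0 < q" "q \<le> 1/2" using p2 by (auto simp: q_def)
  have "q ^ Suc a \<le> q ^ 2" using q a by (intro power_decreasing) auto
  also have "q ^ 2 < q" using q by (simp add: power2_eq_square)
  finally have t: "0 < t" "t < q" using q by (auto simp: t_def)
  have pq: "real p powr -\<kappa> = q powr \<kappa>" using p2 by (simp add: q_def powr_divide powr_minus_divide)
  show "prime_power_factor \<kappa> p a \<le> prime_limit_factor \<kappa> p"
    unfolding prime_power_factor_def prime_limit_factor_def pq q_def[symmetric] t_def[symmetric]
    using t q \<kappa> by (intro divide_right_mono powr_diff_shift_le) auto
  have qk: "q powr \<kappa> \<le> 1 / 2" using inverse_prime_powr_le[OF p \<kappa>] q unfolding pq q_def[symmetric] by simp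
  \<comment> \<open>The factor 2 makes the additive loss \<open>\<kappa> * t\<close> a relative one,
    since \<open>1 - q powr \<kappa> \<ge> 1/2\<close>.\<close>
  have "\<kappa> * t \<le> 2 * \<kappa> * t * (1 - q powr \<kappa>)"
    using mult_left_mono[of "1/2" "1 - q powr \<kappa>" "2 * \<kappa> * t"] qk t \<kappa> by simp
  then have "(1 - q powr \<kappa>) * (1 - 2 * \<kappa> * t) \<le> 1 - \<kappa> * t - q powr \<kappa>"
    by (simp add: algebra_simps)
  also have "\<dots> \<le> (1 - t) powr \<kappa> - (q - t) powr \<kappa>"
    using powr_one_minus_ge[of t \<kappa>] powr_mono2[of \<kappa> "q - t" q] t q \<kappa> by simp
  finally show "prime_limit_factor \<kappa> p * (1 - 2 * \<kappa> * (1 / real p) ^ Suc a) \<le> prime_power_factor \<kappa> p a"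
    unfolding prime_power_factor_def prime_limit_factor_def pq q_def[symmetric] t_def[symmetric]
    by (simp add: divide_right_mono)
qed

section \<open>The maximal order\<close>

lemma divisor_sum_lcm_upper:
  assumes n: "n > 0" and \<kappa>: "\<kappa> \<ge> 1"
  shows "divisor_sum_lcm \<kappa> n \<le> real n powr \<kappa> * (\<Prod>p\<in>prime_factors n. prime_limit_factor \<kappa> p)"
proof -
  have "divisor_sum_lcm \<kappa> (\<Prod>p\<in>prime_factors n. p ^ multiplicity p n) =
      real (\<Prod>p\<in>prime_factors n. p ^ multiplicity p n) powr \<kappa> *
      (\<Prod>p\<in>prime_factors n. prime_power_factor \<kappa> p (multiplicity p n))"
    by (rule divisor_sum_lcm_prod_prime_powers[OF finite_set_mset]) (auto simp: prime_factors_multiplicity)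
  then have "divisor_sum_lcm \<kappa> n = real n powr \<kappa> * (\<Prod>p\<in>prime_factors n. prime_power_factor \<kappa> p (multiplicity p n))"
    using prime_factorization_nat[OF n] by simp
  also have "\<dots> \<le> real n powr \<kappa> * (\<Prod>p\<in>prime_factors n. prime_limit_factor \<kappa> p)"
  proof (intro mult_left_mono prod_mono conjI)
    fix p assume "p \<in> prime_factors n"
    then have p: "prime p" "multiplicity p n > 0" by (auto simp: prime_factors_multiplicity)
    show "prime_power_factor \<kappa> p (multiplicity p n) \<le> prime_limit_factor \<kappa> p"
      by (rule prime_power_factor_bounds(1)[OF p \<kappa>])
    \<comment> \<open>Multiplying the inequalities needs nonnegative factors. As
      \<open>q ^ (a + 1) \<le> q\<close> for \<open>q = 1 / p\<close>, both bases are nonnegative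
      and \<open>powr\<close> is monotone there.\<close>
    have "real p > 1" using prime_gt_1_nat[OF p(1)] by simp
    moreover from this have "(1 / real p) ^ Suc (multiplicity p n) \<le> 1 / real p"
      using power_decreasing[of 1 "Suc (multiplicity p n)" "1 / real p"] by simp
    ultimately show "0 \<le> prime_power_factor \<kappa> p (multiplicity p n)"
      unfolding prime_power_factor_def using \<kappa> by (intro divide_nonneg_nonneg) (auto intro!: powr_mono2)
  qed auto
  finally show ?thesis .
qed

text \<open>The product of these distinct primes divides \<open>n\<close>, and each of them exceeds
  \<open>x\<close>.\<close>

lemma card_large_prime_factors_le:
  assumes n: "n > 0" and x: "x > 1"
  shows "real (card {p \<in> prime_factors n. real p > x}) \<le> ln (real n) / ln x"
proof -
  let ?B = "{p \<in> prime_factors n. real p > x}"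
  have "\<Prod>?B dvd n" by (rule prod_primes_dvd) auto
  then have "\<Prod>?B \<le> n" using n by (rule dvd_imp_le)
  have "x ^ card ?B = (\<Prod>p\<in>?B. x)" by simp
  also have "\<dots> \<le> (\<Prod>p\<in>?B. real p)" using x by (intro prod_mono) auto
  also have "\<dots> = real (\<Prod>?B)" by simp
  also have "\<dots> \<le> real n" using \<open>\<Prod>?B \<le> n\<close> by (rule of_nat_mono)
  finally have "ln (x ^ card ?B) \<le> ln (real n)" using n x by (subst ln_le_cancel_iff) auto
  then show ?thesis using x by (simp add: ln_realpow field_simps)
qed

text \<open>Missing primes up to \<open>x\<close> are added at no loss, their factors being at least
  1. Each prime beyond \<open>x\<close> contributes at most
  \<open>(1 - 1 / x) powr -\<kappa>\<close>, and at most \<open>ln n / ln x\<close> of them divide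
  \<open>n\<close>.\<close>

lemma prod_prime_limit_factor_le:
  assumes n: "n > 0" and x: "x > 1" and \<kappa>: "\<kappa> \<ge> 1"
  shows "(\<Prod>p\<in>prime_factors n. prime_limit_factor \<kappa> p) \<le>
    (\<Prod>p | prime p \<and> p \<le> nat \<lfloor>x\<rfloor>. prime_limit_factor \<kappa> p) * (1 - 1 / x) powr (-\<kappa> * (ln (real n) / ln x))"
proof -
  let ?f = "prime_limit_factor \<kappa>"
  let ?A = "{p \<in> prime_factors n. real p \<le> x}"
  let ?B = "{p \<in> prime_factors n. real p > x}"
  have f1: "?f p \<ge> 1" if "prime p" for p using prime_limit_factor_bounds(1)[OF that \<kappa>] .
  then have f0: "?f p \<ge> 0" if "prime p" for p using that by (meson order_trans zero_le_one)
  have le_iff: "real p \<le> x \<longleftrightarrow> p \<le> nat \<lfloor>x\<rfloor>" for p using x by (simp add: le_nat_iff le_floor_iff)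
  have "prime_factors n = ?A \<union> ?B" by auto
  then have "prod ?f (prime_factors n) = prod ?f (?A \<union> ?B)" by simp
  also have "\<dots> = prod ?f ?A * prod ?f ?B" by (rule prod.union_disjoint) auto
  also have "\<dots> \<le> (\<Prod>p | prime p \<and> p \<le> nat \<lfloor>x\<rfloor>. ?f p) * (1 - 1 / x) powr (-\<kappa> * (ln (real n) / ln x))"
  proof (rule mult_mono)
    show "prod ?f ?A \<le> (\<Prod>p | prime p \<and> p \<le> nat \<lfloor>x\<rfloor>. ?f p)"
    proof (rule prod_mono2[OF finite_primes_le])
      show "?A \<subseteq> {p. prime p \<and> p \<le> nat \<lfloor>x\<rfloor>}" using le_iff by auto
      show "1 \<le> ?f b" if "b \<in> {p. prime p \<and> p \<le> nat \<lfloor>x\<rfloor>} - ?A" for b using that f1 by auto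
      show "0 \<le> ?f a" if "a \<in> ?A" for a
        using that f1[of a] by (auto simp: in_prime_factors_iff)
    qed
    have "prod ?f ?B \<le> (\<Prod>p\<in>?B. (1 - 1 / x) powr -\<kappa>)"
    proof (intro prod_mono conjI)
      fix p assume "p \<in> ?B"
      then have p: "prime p" "real p > x" by auto
      show "0 \<le> ?f p" using f1[OF p(1)] by simp
      have "?f p \<le> (1 - 1 / real p) powr -\<kappa>" by (rule prime_limit_factor_bounds(2)[OF p(1) \<kappa>])
      also have "\<dots> \<le> (1 - 1 / x) powr -\<kappa>"
        using p x \<kappa> by (intro powr_mono2') (auto intro: divide_left_mono)
      finally show "?f p \<le> (1 - 1 / x) powr -\<kappa>" .
    qed
    also have "\<dots> = (1 - 1 / x) powr (-\<kappa> * real (card ?B))"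
      using x by (simp add: powr_power mult.commute)
    also have "\<dots> \<le> (1 - 1 / x) powr (-\<kappa> * (ln (real n) / ln x))"
      using x \<kappa> by (intro powr_mono' mult_left_mono_neg card_large_prime_factors_le[OF n x]) auto
    finally show "prod ?f ?B \<le> (1 - 1 / x) powr (-\<kappa> * (ln (real n) / ln x))" .
    show "0 \<le> (\<Prod>p | prime p \<and> p \<le> nat \<lfloor>x\<rfloor>. ?f p)"
      by (intro prod_nonneg) (auto intro!: f0)
    show "0 \<le> prod ?f ?B" by (intro prod_nonneg) (auto intro!: f0)
  qed
  finally show ?thesis .
qed

text \<open>The product separates into the Euler product, with limit
  \<open>1 / \<zeta>(\<kappa>)\<close>, and the \<kappa>-th power of Mertens' product.\<close>

lemma prod_prime_limit_factor_asymp: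
  assumes \<kappa>: "\<kappa> > 1"
  shows "((\<lambda>x. real_zeta \<kappa> * (\<Prod>p | prime p \<and> p \<le> nat \<lfloor>x\<rfloor>. prime_limit_factor \<kappa> p)
           / (exp euler_mascheroni * ln x) powr \<kappa>) \<longlongrightarrow> 1) at_top"
proof (rule Lim_transform_eventually)
  let ?P = "\<lambda>x. \<Prod>p | prime p \<and> p \<le> nat \<lfloor>x\<rfloor>. 1 / (1 - 1 / real p)"
  let ?Q = "\<lambda>x::real. \<Prod>p | prime p \<and> p \<le> nat \<lfloor>x\<rfloor>. 1 - real p powr -\<kappa>"
  have z: "real_zeta \<kappa> > 0" using real_zeta_ge_1[OF \<kappa>] by simp
  have "filterlim (\<lambda>x::real. nat \<lfloor>x\<rfloor>) at_top at_top"
    by (intro filterlim_compose[OF filterlim_nat_sequentially] filterlim_floor_sequentially)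
  from filterlim_compose[OF euler_product_zeta[OF \<kappa>] this]
  have Q: "(?Q \<longlongrightarrow> 1 / real_zeta \<kappa>) at_top" .
  have "((\<lambda>x. (?P x / ln x / exp euler_mascheroni) powr \<kappa>) \<longlongrightarrow> (exp euler_mascheroni / exp euler_mascheroni) powr \<kappa>) at_top"
    by (intro tendsto_intros mertens_third) auto
  from tendsto_mult[OF tendsto_mult[OF tendsto_const[of "real_zeta \<kappa>"] Q] this]
  show "((\<lambda>x. real_zeta \<kappa> * ?Q x * (?P x / ln x / exp euler_mascheroni) powr \<kappa>) \<longlongrightarrow> 1) at_top"
    using z by simp
  show "\<forall>\<^sub>F x in at_top. real_zeta \<kappa> * ?Q x * (?P x / ln x / exp euler_mascheroni) powr \<kappa> =
      real_zeta \<kappa> * (\<Prod>p | prime p \<and> p \<le> nat \<lfloor>x\<rfloor>. prime_limit_factor \<kappa> p) / (exp euler_mascheroni * ln x) powr \<kappa>"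
    using eventually_gt_at_top[of "1::real"]
  proof eventually_elim
    case (elim x)
    have P0: "?P x \<ge> 0" by (intro prod_nonneg) (auto dest!: prime_gt_0_nat)
    have "(\<Prod>p | prime p \<and> p \<le> nat \<lfloor>x\<rfloor>. prime_limit_factor \<kappa> p) =
        (\<Prod>p | prime p \<and> p \<le> nat \<lfloor>x\<rfloor>. (1 - real p powr -\<kappa>) * (1 / (1 - 1 / real p)) powr \<kappa>)"
    proof (intro prod.cong refl)
      fix p assume "p \<in> {p. prime p \<and> p \<le> nat \<lfloor>x\<rfloor>}"
      then have "real p > 1" by (auto dest: prime_gt_1_nat)
      then have "(1 / (1 - 1 / real p)) powr \<kappa> = 1 powr \<kappa> / (1 - 1 / real p) powr \<kappa>"
        by (simp only: powr_divide)
      then show "prime_limit_factor \<kappa> p = (1 - real p powr -\<kappa>) * (1 / (1 - 1 / real p)) powr \<kappa>"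
        by (simp add: prime_limit_factor_def)
    qed
    also have "\<dots> = ?Q x * ?P x powr \<kappa>"
      unfolding prod.distrib by (subst prod_powr_distrib) (auto dest!: prime_gt_0_nat)
    finally have F: "(\<Prod>p | prime p \<and> p \<le> nat \<lfloor>x\<rfloor>. prime_limit_factor \<kappa> p) = ?Q x * ?P x powr \<kappa>" .
    have "(?P x / ln x / exp euler_mascheroni) powr \<kappa> = (?P x / (exp euler_mascheroni * ln x)) powr \<kappa>"
      by (simp add: field_simps)
    also have "\<dots> = ?P x powr \<kappa> / (exp euler_mascheroni * ln x) powr \<kappa>"
      by (simp only: powr_divide)
    finally show ?case unfolding F by simp
  qed
qed

text \<open>The cut \<open>x = ln n\<close> turns \<open>ln x\<close> into \<open>ln (ln n)\<close>.
  The large primes cost a power of \<open>1 - 1 / ln n\<close> with exponent of order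
  \<open>ln n / ln (ln n)\<close>, which tends to 1.\<close>

lemma divisor_sum_lcm_ratio_upper:
  assumes \<kappa>: "\<kappa> > 1"
  shows "\<exists>Y. (Y \<longlonglongrightarrow> 1) \<and> (\<forall>\<^sub>F n in sequentially.
    real_zeta \<kappa> * divisor_sum_lcm \<kappa> n / (exp euler_mascheroni * real n * ln (ln (real n))) powr \<kappa> \<le> Y n)"
proof -
  define G where "G x = real_zeta \<kappa> * (\<Prod>p | prime p \<and> p \<le> nat \<lfloor>x\<rfloor>. prime_limit_factor \<kappa> p)
           / (exp euler_mascheroni * ln x) powr \<kappa>" for x
  define R where "R n = (1 - 1 / ln (real n)) powr (-\<kappa> * (ln (real n) / ln (ln (real n))))" for n :: nat
  have "filterlim (\<lambda>n::nat. ln (real n)) at_top at_top" by real_asymp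
  from filterlim_compose[OF prod_prime_limit_factor_asymp[OF \<kappa>] this]
  have "(\<lambda>n::nat. G (ln (real n))) \<longlonglongrightarrow> 1" unfolding G_def .
  moreover have "R \<longlonglongrightarrow> 1" unfolding R_def by real_asymp
  ultimately have "(\<lambda>n. G (ln (real n)) * R n) \<longlonglongrightarrow> 1"
    using tendsto_mult[of "\<lambda>n. G (ln (real n))" 1 sequentially R 1] by simp
  moreover have "\<forall>\<^sub>F n in sequentially.
    real_zeta \<kappa> * divisor_sum_lcm \<kappa> n / (exp euler_mascheroni * real n * ln (ln (real n))) powr \<kappa> \<le> G (ln (real n)) * R n"
  proof -
    have "\<forall>\<^sub>F n in sequentially. ln (real n) > 1" by real_asymp
    then show ?thesis using eventually_gt_at_top[of 0]
    proof eventually_elim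
      case (elim n)
      let ?D = "(exp euler_mascheroni * ln (ln (real n))) powr \<kappa>"
      let ?F = "\<Prod>p | prime p \<and> p \<le> nat \<lfloor>ln (real n)\<rfloor>. prime_limit_factor \<kappa> p"
      have D: "(exp euler_mascheroni * real n * ln (ln (real n))) powr \<kappa> = real n powr \<kappa> * ?D"
        using elim by (subst powr_mult[symmetric]) (auto simp: mult_ac)
      have "divisor_sum_lcm \<kappa> n \<le> real n powr \<kappa> * (\<Prod>p\<in>prime_factors n. prime_limit_factor \<kappa> p)"
        using elim \<kappa> by (intro divisor_sum_lcm_upper) auto
      also have "\<dots> \<le> real n powr \<kappa> * (?F * R n)"
        unfolding R_def using elim \<kappa> by (intro mult_left_mono prod_prime_limit_factor_le) auto
      finally have "real_zeta \<kappa> * divisor_sum_lcm \<kappa> n / (real n powr \<kappa> * ?D) \<le>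
          real_zeta \<kappa> * (real n powr \<kappa> * (?F * R n)) / (real n powr \<kappa> * ?D)"
        using real_zeta_ge_1[OF \<kappa>] by (intro divide_right_mono mult_left_mono) auto
      also have "\<dots> = G (ln (real n)) * R n"
        using elim by (simp add: G_def)
      finally show ?case unfolding D .
    qed
  qed
  ultimately show ?thesis by blast
qed

text \<open>The extremal numbers contain every prime up to \<open>exp M\<close> to the power
  \<open>2 * M\<close>. Their logarithm is at most \<open>2 * M\<^sup>2 * exp M\<close>, so
  \<open>ln (ln (r M))\<close> is at most \<open>M + ln (2 * M\<^sup>2)\<close>; it stands in the
  denominator, hence an upper bound is enough.\<close>

lemma divisor_sum_lcm_ratio_lower:
  assumes \<kappa>: "\<kappa> > 1"
  shows "\<exists>r Y. filterlim r at_top sequentially \<and> (Y \<longlonglongrightarrow> 1) \<and> (\<forall>\<^sub>F M in sequentially.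
    Y M \<le> real_zeta \<kappa> * divisor_sum_lcm \<kappa> (r M) / (exp euler_mascheroni * real (r M) * ln (ln (real (r M)))) powr \<kappa>)"
proof -
  define E where "E M = {p. prime p \<and> p \<le> nat \<lfloor>exp (real M)\<rfloor>}" for M :: nat
  define r where "r M = (\<Prod>p\<in>E M. p ^ (2 * M))" for M :: nat
  define G where "G x = real_zeta \<kappa> * (\<Prod>p | prime p \<and> p \<le> nat \<lfloor>x\<rfloor>. prime_limit_factor \<kappa> p)
           / (exp euler_mascheroni * ln x) powr \<kappa>" for x
  \<comment> \<open>At most \<open>exp M\<close> primes each lose a relative
    \<open>2 * \<kappa> * (1/2) ^ (2 * M + 1)\<close> or less. In total this is
    \<open>\<kappa> * (exp 1 / 4) ^ M\<close>, which tends to 0; prime exponents \<open>M\<close>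
    would give the base \<open>exp 1 / 2 > 1\<close>.\<close>
  define \<delta> where "\<delta> M = exp (real M) * (2 * \<kappa> * (1/2) ^ Suc (2 * M))" for M :: nat
  \<comment> \<open>The last factor pays for replacing \<open>M\<close>, the logarithm of the cut,
    by the bound for \<open>ln (ln (r M))\<close>.\<close>
  define Y where "Y M = G (exp (real M)) * (1 - \<delta> M) * (real M / (real M + ln (2 * real M ^ 2))) powr \<kappa>" for M :: nat
  have fin: "finite (E M)" for M unfolding E_def by (rule finite_primes_le)
  have E_le: "real p \<le> exp (real M)" "prime p" "real p \<ge> 2" if "p \<in> E M" for p M
    using that by (auto simp: E_def le_nat_iff le_floor_iff dest: prime_ge_2_nat)
  have card_E: "real (card (E M)) \<le> exp (real M)" for M
  proof -
    have "card (E M) \<le> card {1..nat \<lfloor>exp (real M)\<rfloor>}"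
      unfolding E_def by (intro card_mono) (auto dest: prime_gt_0_nat)
    then show ?thesis by (simp add: le_nat_iff le_floor_iff)
  qed
  have r_ge: "2 ^ (2 * M) \<le> r M" if "M \<ge> 1" for M
  proof -
    have "real M \<ge> 1" using that by simp
    then have "exp (real M) \<ge> 2" using exp_ge_add_one_self[of "real M"] by linarith
    then have 2: "2 \<in> E M" by (simp add: E_def le_nat_iff le_floor_iff)
    have "2 ^ (2 * M) dvd r M" unfolding r_def by (rule dvd_prodI[OF fin 2])
    moreover have "r M > 0" unfolding r_def by (intro prod_pos) (auto dest: E_le(2) prime_gt_0_nat)
    ultimately show ?thesis by (rule dvd_imp_le)
  qed
  have "filterlim r at_top sequentially"
  proof (rule filterlim_at_top_mono[OF filterlim_ident])
    show "\<forall>\<^sub>F M in sequentially. M \<le> r M"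
      using eventually_ge_at_top[of 1]
    proof eventually_elim
      case (elim M)
      have "M \<le> 2 ^ (2 * M)" using less_exp[of "2 * M"] by linarith
      with r_ge[OF elim] show ?case by linarith
    qed
  qed
  moreover have "Y \<longlonglongrightarrow> 1"
  proof -
    have "filterlim (\<lambda>n::nat. exp (real n)) at_top at_top" by real_asymp
    from filterlim_compose[OF prod_prime_limit_factor_asymp[OF \<kappa>] this]
    have 1: "(\<lambda>n::nat. G (exp (real n))) \<longlonglongrightarrow> 1" unfolding G_def .
    have 2: "(\<lambda>M. 1 - \<delta> M) \<longlonglongrightarrow> 1"
    proof -
      have "(\<lambda>M. \<kappa> * (exp (1::real) / 4) ^ M) \<longlonglongrightarrow> \<kappa> * 0"
        using e_less_272 by (intro tendsto_intros LIMSEQ_power_zero) auto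
      moreover have "\<kappa> * (exp (1::real) / 4) ^ M = \<delta> M" for M
        by (simp add: \<delta>_def exp_of_nat_mult[of M 1, simplified] power_mult power_divide)
      ultimately have "\<delta> \<longlonglongrightarrow> 0" by simp
      from tendsto_diff[OF tendsto_const[of 1] this] show ?thesis by simp
    qed
    have 3: "(\<lambda>M::nat. (real M / (real M + ln (2 * real M ^ 2))) powr \<kappa>) \<longlonglongrightarrow> 1"
    proof -
      have "(\<lambda>M::nat. real M / (real M + ln (2 * real M ^ 2))) \<longlonglongrightarrow> 1" by real_asymp
      from tendsto_powr[OF this tendsto_const[of \<kappa>]] show ?thesis by simp
    qed
    from tendsto_mult[OF tendsto_mult[OF 1 2] 3] show ?thesis unfolding Y_def by simp
  qed
  moreover have "\<forall>\<^sub>F M in sequentially.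
    Y M \<le> real_zeta \<kappa> * divisor_sum_lcm \<kappa> (r M) / (exp euler_mascheroni * real (r M) * ln (ln (real (r M)))) powr \<kappa>"
  proof -
    have "\<forall>\<^sub>F M in sequentially. 2 * \<kappa> * (1/2) ^ Suc (2 * M) \<le> 1" by real_asymp
    then show ?thesis using eventually_ge_at_top[of 2]
    proof eventually_elim
      case (elim M)
      let ?F = "\<Prod>p\<in>E M. prime_limit_factor \<kappa> p"
      let ?L = "real M + ln (2 * real M ^ 2)"
      have F0: "?F \<ge> 0"
      proof (rule prod_nonneg)
        fix p assume "p \<in> E M"
        then have "prime_limit_factor \<kappa> p \<ge> 1" using \<kappa> by (intro prime_limit_factor_bounds(1) E_le(2)) auto
        then show "0 \<le> prime_limit_factor \<kappa> p" by simp
      qed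
      have pw: "(1 / real p) ^ Suc (2 * M) \<le> (1/2) ^ Suc (2 * M)" if "p \<in> E M" for p
        using E_le(3)[OF that] by (intro power_mono) (auto simp: field_simps)
      have "1 - \<delta> M \<le> 1 - (\<Sum>p\<in>E M. 2 * \<kappa> * (1 / real p) ^ Suc (2 * M))"
      proof -
        have "(\<Sum>p\<in>E M. 2 * \<kappa> * (1 / real p) ^ Suc (2 * M)) \<le> (\<Sum>p\<in>E M. 2 * \<kappa> * (1/2) ^ Suc (2 * M))"
          using \<kappa> pw by (intro sum_mono mult_left_mono) auto
        also have "\<dots> = real (card (E M)) * (2 * \<kappa> * (1/2) ^ Suc (2 * M))" by simp
        also have "\<dots> \<le> \<delta> M" unfolding \<delta>_def using card_E \<kappa> by (intro mult_right_mono) auto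
        finally show ?thesis by simp
      qed
      \<comment> \<open>Weierstrass' product inequality needs each loss in \<open>[0, 1]\<close>;
        the worst prime is 2, for which \<open>elim(1)\<close> provides it.\<close>
      also have "\<dots> \<le> (\<Prod>p\<in>E M. 1 - 2 * \<kappa> * (1 / real p) ^ Suc (2 * M))"
      proof (rule Weierstrass_prod_ineq)
        fix p assume p: "p \<in> E M"
        have "2 * \<kappa> * (1 / real p) ^ Suc (2 * M) \<le> 2 * \<kappa> * (1/2) ^ Suc (2 * M)"
          using \<kappa> pw[OF p] by (intro mult_left_mono) auto
        also have "\<dots> \<le> 1" by (rule elim(1))
        finally show "2 * \<kappa> * (1 / real p) ^ Suc (2 * M) \<in> {0..1}" using \<kappa> by simp
      qed
      finally have "?F * (1 - \<delta> M) \<le> ?F * (\<Prod>p\<in>E M. 1 - 2 * \<kappa> * (1 / real p) ^ Suc (2 * M))"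
        using F0 by (rule mult_left_mono)
      also have "\<dots> = (\<Prod>p\<in>E M. prime_limit_factor \<kappa> p * (1 - 2 * \<kappa> * (1 / real p) ^ Suc (2 * M)))"
        by (rule prod.distrib[symmetric])
      also have "\<dots> \<le> (\<Prod>p\<in>E M. prime_power_factor \<kappa> p (2 * M))"
      proof (intro prod_mono conjI)
        fix p assume p: "p \<in> E M"
        show "prime_limit_factor \<kappa> p * (1 - 2 * \<kappa> * (1 / real p) ^ Suc (2 * M)) \<le> prime_power_factor \<kappa> p (2 * M)"
          using E_le(2)[OF p] \<kappa> elim(2) by (intro prime_power_factor_bounds(2)) auto
        have "2 * \<kappa> * (1 / real p) ^ Suc (2 * M) \<le> 2 * \<kappa> * (1/2) ^ Suc (2 * M)"
          using \<kappa> pw[OF p] by (intro mult_left_mono) auto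
        then show "0 \<le> prime_limit_factor \<kappa> p * (1 - 2 * \<kappa> * (1 / real p) ^ Suc (2 * M))"
          using prime_limit_factor_bounds(1)[OF E_le(2)[OF p], of \<kappa>] \<kappa> elim(1)
          by (intro mult_nonneg_nonneg) linarith+
      qed
      finally have main: "?F * (1 - \<delta> M) \<le> (\<Prod>p\<in>E M. prime_power_factor \<kappa> p (2 * M))" .
      have S: "divisor_sum_lcm \<kappa> (r M) = real (r M) powr \<kappa> * (\<Prod>p\<in>E M. prime_power_factor \<kappa> p (2 * M))"
        unfolding r_def using elim(2) by (intro divisor_sum_lcm_prod_prime_powers fin E_le(2)) auto
      have r0: "real (r M) \<ge> 4 ^ M"
      proof -
        have "real (2 ^ (2 * M)) \<le> real (r M)" using r_ge elim(2) by (intro of_nat_mono) auto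
        then show ?thesis by (simp add: power_mult)
      qed
      have rpos: "real (r M) > 0" by (rule less_le_trans[OF _ r0]) simp
      \<comment> \<open>From \<open>M \<ge> 2\<close> one gets \<open>r M \<ge> 16 > exp 1\<close>.
        Thus \<open>ln (ln (r M))\<close> is positive, as required for comparing the
        denominators.\<close>
      have ln_r: "ln (real (r M)) > 1"
      proof -
        have "(4::real) ^ 2 \<le> 4 ^ M" using elim(2) by (intro power_increasing) auto
        then have "(16::real) \<le> 4 ^ M" by simp
        then have "exp 1 < real (r M)" using r0 e_less_272 by linarith
        then have "ln (exp 1) < ln (real (r M))" using rpos by (subst ln_less_cancel_iff) auto
        then show ?thesis by simp
      qed
      have "ln (real (r M)) = (\<Sum>p\<in>E M. real (2 * M) * ln (real p))"
      proof -
        have "real p ^ (2 * M) \<noteq> 0" if "p \<in> E M" for p using E_le(3)[OF that] by auto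
        from ln_prod[OF fin this] show ?thesis
          unfolding r_def of_nat_prod of_nat_power ln_realpow .
      qed
      also have "\<dots> \<le> (\<Sum>p\<in>E M. real (2 * M) * real M)"
      proof (intro sum_mono mult_left_mono)
        fix p assume p: "p \<in> E M"
        have "ln (real p) \<le> ln (exp (real M))" using E_le[OF p] by (subst ln_le_cancel_iff) auto
        then show "ln (real p) \<le> real M" by simp
      qed auto
      also have "\<dots> = real (card (E M)) * (2 * real M ^ 2)" by (simp add: power2_eq_square)
      also have "\<dots> \<le> exp (real M) * (2 * real M ^ 2)" using card_E by (intro mult_right_mono) auto
      finally have "ln (ln (real (r M))) \<le> ln (exp (real M) * (2 * real M ^ 2))"
        using ln_r elim(2) by (subst ln_le_cancel_iff) auto
      also have "\<dots> = ?L" using elim(2) by (simp add: ln_mult)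
      finally have lnln: "ln (ln (real (r M))) \<le> ?L" .
      have lnln0: "ln (ln (real (r M))) > 0" using ln_r by simp
      let ?g = "exp euler_mascheroni :: real"
      have "Y M = real_zeta \<kappa> * (?F * (1 - \<delta> M)) / (?g * ?L) powr \<kappa>"
      proof -
        have "(real M / ?L) powr \<kappa> = real M powr \<kappa> / ?L powr \<kappa>"
          by (simp only: powr_divide)
        moreover have "(?g * real M) powr \<kappa> = ?g powr \<kappa> * real M powr \<kappa>" by (simp only: powr_mult)
        moreover have "(?g * ?L) powr \<kappa> = ?g powr \<kappa> * ?L powr \<kappa>"
          by (simp only: powr_mult)
        ultimately show ?thesis using elim(2) unfolding Y_def G_def E_def by simp
      qed
      also have "\<dots> \<le> real_zeta \<kappa> * (\<Prod>p\<in>E M. prime_power_factor \<kappa> p (2 * M)) / (?g * ?L) powr \<kappa>"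
        using main real_zeta_ge_1[OF \<kappa>] by (intro divide_right_mono mult_left_mono) auto
      also have "\<dots> \<le> real_zeta \<kappa> * (\<Prod>p\<in>E M. prime_power_factor \<kappa> p (2 * M)) / (?g * ln (ln (real (r M)))) powr \<kappa>"
      proof (rule divide_left_mono)
        show "(?g * ln (ln (real (r M)))) powr \<kappa> \<le> (?g * ?L) powr \<kappa>"
          using lnln lnln0 \<kappa> by (intro powr_mono2) auto
        have "0 \<le> prime_power_factor \<kappa> p (2 * M)" if p: "p \<in> E M" for p
        proof -
          have "(1 / real p) ^ Suc (2 * M) \<le> 1 / real p"
            using power_decreasing[of 1 "Suc (2 * M)" "1 / real p"] E_le(3)[OF p] by simp
          then show ?thesis unfolding prime_power_factor_def using \<kappa> E_le(3)[OF p]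
            by (intro divide_nonneg_nonneg) (auto intro!: powr_mono2)
        qed
        then show "0 \<le> real_zeta \<kappa> * (\<Prod>p\<in>E M. prime_power_factor \<kappa> p (2 * M))"
          using real_zeta_ge_1[OF \<kappa>] by (intro mult_nonneg_nonneg prod_nonneg) auto
        show "0 < (?g * ?L) powr \<kappa> * (?g * ln (ln (real (r M)))) powr \<kappa>"
          using lnln lnln0 by (intro mult_pos_pos) auto
      qed
      also have "\<dots> = real_zeta \<kappa> * divisor_sum_lcm \<kappa> (r M) / (?g * real (r M) * ln (ln (real (r M)))) powr \<kappa>"
      proof -
        have "(?g * real (r M) * ln (ln (real (r M)))) powr \<kappa> = real (r M) powr \<kappa> * (?g * ln (ln (real (r M)))) powr \<kappa>"
          using lnln0 by (subst powr_mult[symmetric]) (auto simp: mult_ac)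
        then show ?thesis unfolding S using rpos by simp
      qed
      finally show ?case .
    qed
  qed
  ultimately show ?thesis by blast
qed

theorem theorem1p4:
  fixes \<kappa> :: real
  assumes "\<kappa> > 1"
  shows "limsup (\<lambda>n. ereal (real_zeta \<kappa> * divisor_sum_lcm \<kappa> n /
           (exp euler_mascheroni * real n * ln (ln (real n))) powr \<kappa>)) = 1"
proof (rule antisym)
  let ?X = "\<lambda>n. real_zeta \<kappa> * divisor_sum_lcm \<kappa> n / (exp euler_mascheroni * real n * ln (ln (real n))) powr \<kappa>"
  obtain Y where Y: "Y \<longlonglongrightarrow> 1" "\<forall>\<^sub>F n in sequentially. ?X n \<le> Y n"
    using divisor_sum_lcm_ratio_upper[OF assms] by blast
  have "limsup (\<lambda>n. ereal (?X n)) \<le> limsup (\<lambda>n. ereal (Y n))"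
    by (rule Limsup_mono) (use Y(2) in simp)
  also have "\<dots> = 1" using lim_imp_Limsup[of sequentially "\<lambda>n. ereal (Y n)" 1] Y(1) by (simp add: one_ereal_def)
  finally show "limsup (\<lambda>n. ereal (?X n)) \<le> 1" .
  obtain r Z where r: "filterlim r at_top sequentially" and Z: "Z \<longlonglongrightarrow> 1" "\<forall>\<^sub>F M in sequentially. Z M \<le> ?X (r M)"
    using divisor_sum_lcm_ratio_lower[OF assms] by blast
  show "1 \<le> limsup (\<lambda>n. ereal (?X n))"
  proof (rule ccontr)
    assume "\<not> 1 \<le> limsup (\<lambda>n. ereal (?X n))"
    then have "limsup (\<lambda>n. ereal (?X n)) < 1" by simp
    \<comment> \<open>A real \<open>c < 1\<close> would bound the ratio at all large arguments,
      hence along \<open>r\<close>, which tends to infinity; but there the minorant \<open>Z\<close>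
      eventually exceeds \<open>c\<close>.\<close>
    then obtain c where c: "limsup (\<lambda>n. ereal (?X n)) < ereal c" "ereal c < 1"
      using ereal_dense2 by blast
    have "\<forall>\<^sub>F n in sequentially. ereal (?X n) < ereal c" by (rule Limsup_lessD[OF c(1)])
    then have "\<forall>\<^sub>F n in sequentially. ?X n < c" by simp
    then have "\<forall>\<^sub>F M in sequentially. ?X (r M) < c" by (rule eventually_compose_filterlim[OF _ r])
    moreover have "\<forall>\<^sub>F M in sequentially. Z M > c"
      using c(2) by (intro order_tendstoD(1)[OF Z(1)]) (simp add: one_ereal_def)
    ultimately have "\<forall>\<^sub>F M in sequentially. False"
      using Z(2) by eventually_elim linarith
    then show False by simp
  qed
qed

end
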